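(* Let $l_\infty$ be a line of $\mathrm{PG}(2,3)$, let $\varphi$ be the Veronese mapping from the points of $\mathrm{PG}(2,3)$ to the points of $\mathrm{PG}(5,3)$, let $\Gamma_\infty:=l_\infty^\varphi$, let $\Delta_\infty$ be the diagonal triangle of the planar quadrangle $\Gamma_\infty$, and let $\mathcal{K}:=(\operatorname{im}\varphi\setminus\Gamma_\infty)\cup\Delta_\infty$. For a set $\mathcal{M}$ of points of $\mathrm{PG}(5,3)$ let $\mathcal{B}(\mathcal{M})$ be the set of all intersections $\mathcal{H}\cap\mathcal{M}$, where $\mathcal{H}$ is a hyperplane of $\mathrm{PG}(5,3)$ with $\#(\mathcal{H}\cap\mathcal{M})>3$. Then the incidence structure $(\mathcal{K},\mathcal{B}(\mathcal{K}),\in)$ is a $5$-$(12,6,1)$ design (Witt's design $W_{12}$). Moreover, such a point model of $W_{12}$ in $\mathrm{PG}(5,3)$ is projectively unique: if $\mathcal{K}'$ is any set of points of $\mathrm{PG}(5,3)$ such that $(\mathcal{K}',\mathcal{B}(\mathcal{K}'),\in)$ is a $5$-$(12,6,1)$ design, then there is a collineation of $\mathrm{PG}(5,3)$ mapping $\mathcal{K}$ onto $\mathcal{K}'$.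
   Context: Let $F=\mathrm{GF}(3)$, let $\mathbf{V}$ be a $3$-dimensional $F$-vector space and $\mathbf{W}=\mathbf{V}\vee\mathbf{V}$ its symmetric tensor square, which has dimension $6$. $\mathrm{PG}(2,3)$ and $\mathrm{PG}(5,3)$ denote the projective spaces on $\mathbf{V}$ and $\mathbf{W}$; their points are the one-dimensional subspaces. The Veronese mapping is $\varphi: F\mathbf{a}\mapsto F(\mathbf{a}\vee\mathbf{a})$; in suitable coordinates, $F(x_0,x_1,x_2)\mapsto F(x_0^2,x_0x_1,x_0x_2,x_1^2,x_1x_2,x_2^2)$. It is injective, and the image under $\varphi$ of a line of $\mathrm{PG}(2,3)$ (viewed as its set of four points) consists of four coplanar points, no three collinear (a planar quadrangle). The diagonal triangle of a quadrangle $\{A,B,C,D\}$ in a projective plane of order $3$ is the set of its three diagonal points $AB\cap CD$, $AC\cap BD$, $AD\cap BC$. A $5$-$(12,6,1)$ design is a $12$-element set of points together with a family of $6$-element subsets (blocks) such that every $5$-element subset of points is contained in exactly one block; it is known to be unique up to isomorphism and is called Witt's design $W_{12}$. A collineation is a bijection of the point set that maps lines onto lines. *)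

theory Defs
  imports "HOL-Analysis.Analysis"
begin

section \<open>Projective spaces over a field\<close>

text \<open>
  The projective space on the vector space \<^typ>\<open>'f::field ^ 'n\<close>. Points are one-dimensional
  subspaces; lines and hyperplanes are identified with the sets of points on them.
\<close>

definition pg_points :: "(('f::field ^ 'n) set) set"
  where "pg_points = {P. vec.subspace P \<and> vec.dim P = 1}"

definition points_on :: "('f::field ^ 'n) set \<Rightarrow> (('f ^ 'n) set) set"
  where "points_on U = {P \<in> pg_points. P \<subseteq> U}"

definition pg_line :: "(('f::field ^ 'n) set) set \<Rightarrow> bool"
  where "pg_line l \<longleftrightarrow> (\<exists>U. vec.subspace U \<and> vec.dim U = 2 \<and> l = points_on U)"

definition pg_hyperplane :: "(('f::field ^ 'n) set) set \<Rightarrow> bool"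
  where "pg_hyperplane h \<longleftrightarrow>
    (\<exists>U. vec.subspace U \<and> vec.dim U + 1 = CARD('n) \<and> h = points_on U)"

definition join_line :: "('f::field ^ 'n) set \<Rightarrow> ('f ^ 'n) set \<Rightarrow> (('f ^ 'n) set) set"
  where "join_line A B = points_on (vec.span (A \<union> B))"

definition pg_collineation :: "(('f::field ^ 'n) set \<Rightarrow> ('f ^ 'n) set) \<Rightarrow> bool"
  where "pg_collineation k \<longleftrightarrow>
    bij_betw k pg_points pg_points \<and> (\<forall>l. pg_line l \<longrightarrow> pg_line (k ` l))"

definition diagonal_triangle :: "(('f::field ^ 'n) set) set \<Rightarrow> (('f ^ 'n) set) set"
  where "diagonal_triangle Q =
    {P. \<exists>A B C D. Q = {A, B, C, D} \<and> card {A, B, C, D} = 4 \<and> join_line A B \<inter> join_line C D = {P}}"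


section \<open>The symmetric square and the Veronese mapping\<close>

text \<open>
  The symmetric square of \<^typ>\<open>'f ^ 3\<close> is realised on \<^typ>\<open>'f ^ 6\<close>, the coordinates being taken
  with respect to the basis \<open>e\<^sub>i \<or> e\<^sub>i\<close>, \<open>2 (e\<^sub>i \<or> e\<^sub>j)\<close> (\<open>i < j\<close>), so that \<open>a \<or> a\<close> has the
  coordinates \<open>a\<^sub>i a\<^sub>j\<close> (\<open>i \<le> j\<close>). This requires \<open>2 \<noteq> 0\<close>; the universal property is proved below.
\<close>

definition sym_prod :: "'f::field ^ 3 \<Rightarrow> 'f ^ 3 \<Rightarrow> 'f ^ 6"
  where "sym_prod a b = vector
    [a $ 1 * b $ 1,
     (a $ 1 * b $ 2 + a $ 2 * b $ 1) / 2,
     (a $ 1 * b $ 3 + a $ 3 * b $ 1) / 2,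
     a $ 2 * b $ 2,
     (a $ 2 * b $ 3 + a $ 3 * b $ 2) / 2,
     a $ 3 * b $ 3]"

definition veronese :: "('f::field ^ 3) set \<Rightarrow> ('f ^ 6) set"
  where "veronese P = vec.span ((\<lambda>a. sym_prod a a) ` P)"

lemma exhaust_6: "x = 1 \<or> x = 2 \<or> x = 3 \<or> x = 4 \<or> x = 5 \<or> x = 6" for x :: 6
proof (induct x)
  case (of_int z)
  then have "0 \<le> z" and "z < 6" by simp_all
  then have "z = 0 \<or> z = 1 \<or> z = 2 \<or> z = 3 \<or> z = 4 \<or> z = 5" by arith
  then show ?case by auto
qed

lemma forall_6: "(\<forall>i::6. P i) \<longleftrightarrow> P 1 \<and> P 2 \<and> P 3 \<and> P 4 \<and> P 5 \<and> P 6"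
  by (metis exhaust_6)

lemma vector_6 [simp]:
  "(vector [a, b, c, d, e, f] :: 'a::zero ^ 6) $ 1 = a"
  "(vector [a, b, c, d, e, f] :: 'a::zero ^ 6) $ 2 = b"
  "(vector [a, b, c, d, e, f] :: 'a::zero ^ 6) $ 3 = c"
  "(vector [a, b, c, d, e, f] :: 'a::zero ^ 6) $ 4 = d"
  "(vector [a, b, c, d, e, f] :: 'a::zero ^ 6) $ 5 = e"
  "(vector [a, b, c, d, e, f] :: 'a::zero ^ 6) $ 6 = f"
  by (simp_all add: vector_def)

lemma sym_prod_same:
  fixes a :: "'f::field ^ 3"
  assumes "(2 :: 'f) \<noteq> 0"
  shows "sym_prod a a =
    vector [a $ 1 * a $ 1, a $ 1 * a $ 2, a $ 1 * a $ 3, a $ 2 * a $ 2, a $ 2 * a $ 3, a $ 3 * a $ 3]"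
  using assms by (simp add: vec_eq_iff forall_6 sym_prod_def field_simps)

lemma sym_prod_commute: "sym_prod a b = sym_prod b a"
  by (simp add: sym_prod_def algebra_simps)

lemma linear_sym_prod: "Vector_Spaces.linear (*s) (*s) (sym_prod a)"
  by unfold_locales
    (simp_all add: vec_eq_iff forall_6 sym_prod_def algebra_simps add_divide_distrib)

lemma veronese_span:
  fixes a :: "'f::field ^ 3"
  assumes "(2 :: 'f) \<noteq> 0"
  shows "veronese (vec.span {a}) = vec.span {vector
    [a $ 1 * a $ 1, a $ 1 * a $ 2, a $ 1 * a $ 3, a $ 2 * a $ 2, a $ 2 * a $ 3, a $ 3 * a $ 3]}"
proof -
  have eq: "sym_prod (c *s a) (c *s a) = (c * c) *s sym_prod a a" for c
    by (simp add: vec_eq_iff forall_6 sym_prod_def field_simps)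
  have "veronese (vec.span {a}) = vec.span {sym_prod a a}"
    unfolding veronese_def
  proof (rule subset_antisym)
    show "vec.span ((\<lambda>a. sym_prod a a) ` vec.span {a}) \<subseteq> vec.span {sym_prod a a}"
    proof (rule vec.span_minimal[OF _ vec.subspace_span])
      show "(\<lambda>a. sym_prod a a) ` vec.span {a} \<subseteq> vec.span {sym_prod a a}"
        by (auto simp: vec.span_singleton eq)
    qed
    show "vec.span {sym_prod a a} \<subseteq> vec.span ((\<lambda>a. sym_prod a a) ` vec.span {a})"
      by (rule vec.span_mono) (auto intro: vec.span_base)
  qed
  then show ?thesis by (simp add: sym_prod_same[OF assms])
qed

lemma sym_prod_universal:
  fixes \<beta> :: "'f::field ^ 3 \<Rightarrow> 'f ^ 3 \<Rightarrow> 'f ^ 'n"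
  assumes two: "(2 :: 'f) \<noteq> 0"
    and lin: "\<And>a. Vector_Spaces.linear (*s) (*s) (\<beta> a)"
    and comm: "\<And>a b. \<beta> a b = \<beta> b a"
  shows "\<exists>!g. Vector_Spaces.linear (*s) (*s) g \<and> (\<forall>a b. \<beta> a b = g (sym_prod a b))"
proof -
  define e :: "3 \<Rightarrow> 'f ^ 3" where "e i = axis i 1" for i
  have add: "\<beta> a (b + c) = \<beta> a b + \<beta> a c" and sc: "\<beta> a (k *s b) = k *s \<beta> a b" for a b c k
    using lin[of a] by (simp_all add: Vector_Spaces.linear_iff)
  have dec: "a = a $ 1 *s e 1 + a $ 2 *s e 2 + a $ 3 *s e 3" for a :: "'f ^ 3"
    by (simp add: vec_eq_iff forall_3 e_def axis_def)
  have expand: "\<beta> a b = b $ 1 *s \<beta> a (e 1) + b $ 2 *s \<beta> a (e 2) + b $ 3 *s \<beta> a (e 3)" for a b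
    by (metis add sc dec)
  have full: "\<beta> a b =
      b $ 1 *s (a $ 1 *s \<beta> (e 1) (e 1) + a $ 2 *s \<beta> (e 1) (e 2) + a $ 3 *s \<beta> (e 1) (e 3))
    + b $ 2 *s (a $ 1 *s \<beta> (e 1) (e 2) + a $ 2 *s \<beta> (e 2) (e 2) + a $ 3 *s \<beta> (e 2) (e 3))
    + b $ 3 *s (a $ 1 *s \<beta> (e 1) (e 3) + a $ 2 *s \<beta> (e 2) (e 3) + a $ 3 *s \<beta> (e 3) (e 3))"
    for a b
  proof -
    have "\<beta> a (e i) = a $ 1 *s \<beta> (e i) (e 1) + a $ 2 *s \<beta> (e i) (e 2) + a $ 3 *s \<beta> (e i) (e 3)" for i
      by (subst comm) (rule expand)
    then show ?thesis
      by (subst expand) (simp only: comm[of "e 2" "e 1"] comm[of "e 3" "e 1"] comm[of "e 3" "e 2"])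
  qed
  define g :: "'f ^ 6 \<Rightarrow> 'f ^ 'n" where "g w =
      w $ 1 *s \<beta> (e 1) (e 1) + (2 * w $ 2) *s \<beta> (e 1) (e 2) + (2 * w $ 3) *s \<beta> (e 1) (e 3)
    + w $ 4 *s \<beta> (e 2) (e 2) + (2 * w $ 5) *s \<beta> (e 2) (e 3) + w $ 6 *s \<beta> (e 3) (e 3)" for w
  show ?thesis
  proof (rule ex1I[of _ g])
    have "Vector_Spaces.linear (*s) (*s) g"
      by unfold_locales (simp_all add: g_def vec_eq_iff algebra_simps)
    moreover have "\<beta> a b = g (sym_prod a b)" for a b
    proof -
      have half: "2 * (x / 2) = x" for x :: 'f
        using two by simp
      show ?thesis
        by (subst full) (simp only: g_def sym_prod_def vector_6 half, simp add: vec_eq_iff algebra_simps)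
    qed
    ultimately show "Vector_Spaces.linear (*s) (*s) g \<and> (\<forall>a b. \<beta> a b = g (sym_prod a b))" by blast
  next
    fix h :: "'f ^ 6 \<Rightarrow> 'f ^ 'n"
    assume h: "Vector_Spaces.linear (*s) (*s) h \<and> (\<forall>a b. \<beta> a b = h (sym_prod a b))"
    then have hadd: "h (x + y) = h x + h y" and hsc: "h (k *s x) = k *s h x" for x y k
      by (simp_all add: Vector_Spaces.linear_iff)
    have "h w = g w" for w
    proof -
      have "w = w $ 1 *s sym_prod (e 1) (e 1) + (2 * w $ 2) *s sym_prod (e 1) (e 2)
        + (2 * w $ 3) *s sym_prod (e 1) (e 3) + w $ 4 *s sym_prod (e 2) (e 2)
        + (2 * w $ 5) *s sym_prod (e 2) (e 3) + w $ 6 *s sym_prod (e 3) (e 3)" (is "w = ?r")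
        using two by (simp add: vec_eq_iff forall_6 sym_prod_def e_def axis_def)
      then have "h w = h ?r" by (rule arg_cong)
      also have "\<dots> = g w"
        using h by (simp only: hadd hsc g_def)
      finally show ?thesis .
    qed
    then show "h = g" by blast
  qed
qed


section \<open>Designs\<close>

definition is_design :: "nat \<Rightarrow> nat \<Rightarrow> nat \<Rightarrow> nat \<Rightarrow> 'p set \<Rightarrow> 'p set set \<Rightarrow> bool"
  where "is_design t v k m X \<B> \<longleftrightarrow>
    finite X \<and> card X = v \<and>
    (\<forall>b\<in>\<B>. b \<subseteq> X \<and> card b = k) \<and>
    (\<forall>T. T \<subseteq> X \<and> card T = t \<longrightarrow> card {b \<in> \<B>. T \<subseteq> b} = m)"

definition hyperplane_blocks :: "(('f::field ^ 'n) set) set \<Rightarrow> (('f ^ 'n) set) set set"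
  where "hyperplane_blocks M = {h \<inter> M | h. pg_hyperplane h \<and> card (h \<inter> M) > 3}"

definition witt_points :: "(('f::field ^ 3) set) set \<Rightarrow> (('f ^ 6) set) set"
  where "witt_points l =
    (veronese ` pg_points - veronese ` l) \<union> diagonal_triangle (veronese ` l)"

end

theory Submission
  imports Defs
begin

text \<open>
  A linear functional cuts out of a set \<open>K\<close> of twelve points the points where it vanishes. The
  hyperplane sections with more than three points form a \<open>5\<close>-\<open>(12,6,1)\<close> design if and only if all of
  them have exactly six points; in coding terms, the weights of the associated ternary code of length
  12 are \<open>6\<close> or at least \<open>9\<close>. For the set \<open>\<K>\<close> this is a finite check in coordinates adapted to the line.

  For the uniqueness choose a basis \<open>B \<subseteq> K\<close>. The hyperplane spanned by \<open>B - {b}\<close> contains exactly one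
  of the six other points, and for \<open>b \<noteq> c\<close> each of the two further hyperplanes through \<open>B - {b, c}\<close>
  contains exactly two of them. Hence the matrix of the
  other points has, in a suitable order, zeros precisely on the diagonal, and any two rows agree in
  two and differ in two of the four places where both are nonzero. After normalising the first row
  and column to ones, the signs of the remaining \<open>5 \<times> 5\<close> block are the adjacencies of a 2-regular
  graph on five vertices, a pentagon. So all such point sets are linearly equivalent.
\<close>

subsection \<open>Functionals, hyperplanes and collineations\<close>

abbreviation functional :: "('f::field ^ 'n \<Rightarrow> 'f) \<Rightarrow> bool"
  where "functional f \<equiv> Vector_Spaces.linear (*s) (*) f"

lemma functional_add: "functional f \<Longrightarrow> f (x + y) = f x + f y"
  by (simp add: Vector_Spaces.linear_iff)

lemma functional_scale: "functional f \<Longrightarrow> f (c *s x) = c * f x"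
  by (simp add: Vector_Spaces.linear_iff)

lemma functional_zero: "functional f \<Longrightarrow> f 0 = 0"
  using functional_scale[of f 0 0] by simp

lemma functional_diff: "functional f \<Longrightarrow> f (x - y) = f x - f y"
  using functional_add[of f "x - y" y] by simp

lemma functional_sum: "functional f \<Longrightarrow> f (sum g A) = (\<Sum>a\<in>A. f (g a))"
  by (induction A rule: infinite_finite_induct) (simp_all add: functional_zero functional_add)

lemma functional_plus: "functional f \<Longrightarrow> functional g \<Longrightarrow> functional (\<lambda>x. f x + g x)"
  by (simp add: Vector_Spaces.linear_iff algebra_simps vec.vector_space_axioms)

lemma functional_minus: "functional f \<Longrightarrow> functional g \<Longrightarrow> functional (\<lambda>x. f x - g x)"
  by (simp add: Vector_Spaces.linear_iff algebra_simps vec.vector_space_axioms)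

lemma subspace_kernel: "functional f \<Longrightarrow> vec.subspace {x. f x = 0}"
  by (simp add: vec.subspace_def functional_zero functional_add functional_scale)

text \<open>Modulo the kernel every vector is a multiple of \<open>w\<close>, so adjoining the
  single outside vector \<open>w\<close> to the kernel yields the whole space.\<close>

lemma dim_kernel:
  fixes f :: "'f::field ^ 'n \<Rightarrow> 'f"
  assumes f: "functional f" and w: "f w \<noteq> 0"
  shows "vec.dim {x. f x = 0} + 1 = CARD('n)"
proof -
  let ?U = "{x. f x = 0}"
  have span: "vec.span ?U = ?U"
    using subspace_kernel[OF f] by (simp add: vec.span_eq_iff)
  have "x \<in> vec.span (insert w ?U)" for x
  proof -
    have "x = (x - (f x / f w) *s w) + (f x / f w) *s w" by simp
    moreover have "x - (f x / f w) *s w \<in> ?U"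
      using w by (simp add: functional_diff[OF f] functional_scale[OF f])
    ultimately show ?thesis
      by (metis insertI1 insertI2 vec.span_add vec.span_base vec.span_scale)
  qed
  then have "vec.dim (insert w ?U) = CARD('n)"
    by (metis UNIV_eq_I vec.dim_eq_full vec.dimension_def vec_dim_card vec.dim_UNIV)
  then show ?thesis
    using w by (simp add: vec.dim_insert span)
qed

text \<open>A basis of the span of \<open>S\<close>, joined by a vector \<open>w\<close> outside,
  extends to a basis of the whole space; the coordinate belonging to \<open>w\<close> is the
  functional.\<close>

lemma functional_vanishing_on:
  fixes S :: "('f::field ^ 'n) set"
  assumes "vec.span S \<noteq> UNIV"
  shows "\<exists>f w. functional f \<and> f w \<noteq> 0 \<and> (\<forall>x\<in>S. f x = 0)"
proof -
  obtain w where w: "w \<notin> vec.span S" using assms by blast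
  obtain B where B: "B \<subseteq> S" "vec.independent B" "S \<subseteq> vec.span B"
    by (rule vec.maximal_independent_subset)
  have wB: "w \<notin> vec.span B" using w B(1) vec.span_mono by blast
  then have ind: "vec.independent (insert w B)"
    using B(2) by (simp add: vec.independent_insertI)
  define E where "E = vec.extend_basis (insert w B)"
  have E: "vec.independent E" "vec.span E = UNIV" "insert w B \<subseteq> E"
    unfolding E_def
    by (rule vec.independent_extend_basis[OF ind] vec.span_extend_basis[OF ind]
        vec.extend_basis_superset[OF ind])+
  define f where "f = (\<lambda>x. vec.representation E x w)"
  have f: "functional f"
    unfolding f_def using E(1,2) by (rule vec.linear_representation)
  have fw: "f w \<noteq> 0"
    using E by (simp add: f_def vec.representation_basis)
  have "B \<subseteq> {x. f x = 0}"
  proof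
    fix b assume "b \<in> B"
    moreover have "b \<noteq> w" using \<open>b \<in> B\<close> wB vec.span_base by blast
    ultimately show "b \<in> {x. f x = 0}"
      using E by (auto simp: f_def vec.representation_basis)
  qed
  then have "vec.span B \<subseteq> {x. f x = 0}"
    using subspace_kernel[OF f] by (rule vec.span_minimal)
  then show ?thesis using f fw B(3) by blast
qed

text \<open>With hyperplanes given as kernels, incidence becomes the evaluation of a functional at a
  vector; all later counting is done in this form.\<close>

lemma pg_hyperplane_iff:
  fixes h :: "('f::field ^ 'n) set set"
  shows "pg_hyperplane h \<longleftrightarrow> (\<exists>f w. functional f \<and> f w \<noteq> 0 \<and> h = points_on {x. f x = 0})"
proof
  assume "pg_hyperplane h"
  then obtain U where U: "vec.subspace U" "vec.dim U + 1 = CARD('n)" "h = points_on U"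
    unfolding pg_hyperplane_def by blast
  have "vec.span U \<noteq> UNIV"
    using U(2) by (metis vec.dim_UNIV vec.dim_span vec_dim_card n_not_Suc_n add.right_neutral Suc_eq_plus1)
  then obtain f w where f: "functional f" "f w \<noteq> 0" "\<forall>x\<in>U. f x = 0"
    using functional_vanishing_on by blast
  \<comment> \<open>The kernel contains \<open>U\<close> and has the same dimension.\<close>
  have "U = {x. f x = 0}"
    by (rule vec.subspace_dim_equal[OF U(1) subspace_kernel[OF f(1)]])
      (use f U(2) dim_kernel[OF f(1,2)] in auto)
  then show "\<exists>f w. functional f \<and> f w \<noteq> 0 \<and> h = points_on {x. f x = 0}"
    using f U(3) by blast
next
  assume "\<exists>f w. functional f \<and> f w \<noteq> 0 \<and> h = points_on {x. f x = 0}"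
  then show "pg_hyperplane h"
    unfolding pg_hyperplane_def using subspace_kernel dim_kernel by blast
qed

lemma span_singleton_subset_iff: "vec.subspace U \<Longrightarrow> vec.span {v} \<subseteq> U \<longleftrightarrow> v \<in> U"
  by (meson empty_subsetI insert_subset subset_trans vec.span_minimal vec.span_superset)

lemma pg_points_iff: "P \<in> pg_points \<longleftrightarrow> (\<exists>v. v \<noteq> 0 \<and> P = vec.span {v})"
proof
  assume P: "P \<in> pg_points"
  then obtain B where B: "B \<subseteq> P" "vec.independent B" "P \<subseteq> vec.span B" "card B = 1"
    using vec.basis_exists[of P] by (auto simp: pg_points_def)
  then obtain v where "B = {v}" by (auto simp: card_1_singleton_iff)
  moreover have "vec.span B = P"
  proof
    show "vec.span B \<subseteq> P"
      using B(1) P by (intro vec.span_minimal) (simp_all add: pg_points_def)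
  qed (rule B(3))
  ultimately show "\<exists>v. v \<noteq> 0 \<and> P = vec.span {v}"
    using B(2) vec.dependent_zero[of B] by auto
next
  assume "\<exists>v. v \<noteq> 0 \<and> P = vec.span {v}"
  then show "P \<in> pg_points" by (auto simp: pg_points_def)
qed

lemma span_singleton_in_pg_points [simp]: "vec.span {v} \<in> pg_points \<longleftrightarrow> v \<noteq> 0"
  by (auto simp: pg_points_def)

lemma span_singleton_eq_iff:
  assumes "v \<noteq> 0"
  shows "vec.span {v} = vec.span {w} \<longleftrightarrow> (\<exists>c. v = c *s w)"
proof
  assume "vec.span {v} = vec.span {w}"
  then have "v \<in> vec.span {w}" using vec.span_base[of v "{v}"] by simp
  then show "\<exists>c. v = c *s w" unfolding vec.span_singleton by blast
next
  assume "\<exists>c. v = c *s w"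
  then obtain c where c: "v = c *s w" by blast
  with assms have "c \<noteq> 0" by auto
  then have w: "w = inverse c *s v" using c by simp
  have "v \<in> vec.span {w}" using c by (simp add: vec.span_scale vec.span_base)
  moreover have "w \<in> vec.span {v}" using w by (simp add: vec.span_scale vec.span_base)
  ultimately show "vec.span {v} = vec.span {w}"
    by (intro subset_antisym) (simp_all add: span_singleton_subset_iff)
qed

lemma span_scaled:
  fixes v :: "'f::field ^ 'n"
  assumes "c \<noteq> 0"
  shows "vec.span {c *s v} = vec.span {v}"
proof (cases "v = 0")
  case False
  then have "c *s v \<noteq> 0" using assms by simp
  then show ?thesis using span_singleton_eq_iff[of "c *s v" v] by blast
qed simp

lemma points_on_Int: "points_on U \<inter> points_on W = points_on (U \<inter> W)"
  by (auto simp: points_on_def)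

lemma points_on_span_singleton:
  assumes "v \<noteq> 0"
  shows "points_on (vec.span {v}) = {vec.span {v}}"
proof (intro equalityI subsetI)
  fix P assume "P \<in> points_on (vec.span {v})"
  then have P: "P \<in> pg_points" "P \<subseteq> vec.span {v}" by (simp_all add: points_on_def)
  from P(1) obtain w where w: "w \<noteq> 0" "P = vec.span {w}" unfolding pg_points_iff by blast
  have "w \<in> vec.span {v}"
    using P(2) unfolding w(2) by (simp add: span_singleton_subset_iff)
  then obtain c where "w = c *s v" unfolding vec.span_singleton by blast
  then have "vec.span {w} = vec.span {v}"
    unfolding span_singleton_eq_iff[OF w(1)] by (rule exI)
  then show "P \<in> {vec.span {v}}" using w(2) by simp
qed (use assms in \<open>simp add: points_on_def\<close>)

lemma join_line_span:
  "join_line (vec.span {a}) (vec.span {b}) = points_on (vec.span {a, b})"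
proof -
  have "vec.span (vec.span {a} \<union> vec.span {b}) = vec.span {a, b}"
  proof
    have "vec.span {a} \<union> vec.span {b} \<subseteq> vec.span {a, b}"
      by (simp add: vec.span_mono)
    then show "vec.span (vec.span {a} \<union> vec.span {b}) \<subseteq> vec.span {a, b}"
      by (simp add: vec.span_minimal)
    show "vec.span {a, b} \<subseteq> vec.span (vec.span {a} \<union> vec.span {b})"
      by (rule vec.span_mono) (auto intro: vec.span_base)
  qed
  then show ?thesis by (simp add: join_line_def)
qed

text \<open>A linear bijection preserves subspaces and their dimensions in both directions, so it
  permutes the points and maps the points on \<open>U\<close> onto the points on the image of
  \<open>U\<close>.\<close>

lemma pg_collineation_linear:
  fixes g :: "'f::field ^ 'n \<Rightarrow> 'f ^ 'n"
  assumes g: "Vector_Spaces.linear (*s) (*s) g" and bij: "bij g"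
  shows "pg_collineation ((`) g)"
proof -
  have inj: "inj g" and surj: "surj g" using bij by (auto simp: bij_def)
  have dim: "vec.dim (g ` S) = vec.dim S" for S
    by (rule vec.dim_image_eq[OF g]) (use inj in \<open>auto intro: inj_on_subset\<close>)
  have sub: "vec.subspace (g ` S) \<longleftrightarrow> vec.subspace S" for S
  proof
    assume "vec.subspace (g ` S)"
    then have "vec.subspace (g -` (g ` S))"
      using vec.linear_subspace_vimage[OF g] by blast
    then show "vec.subspace S" by (simp add: inj inj_vimage_image_eq)
  qed (rule vec.linear_subspace_image[OF g])
  have inj_im: "inj ((`) g)" using inj by (auto simp: inj_def inj_image_eq_iff)
  have img: "(`) g ` points_on U = points_on (g ` U)" for U
  proof
    show "(`) g ` points_on U \<subseteq> points_on (g ` U)"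
      by (auto simp: points_on_def pg_points_def sub dim)
    show "points_on (g ` U) \<subseteq> (`) g ` points_on U"
    proof
      fix P assume P: "P \<in> points_on (g ` U)"
      define Q where "Q = g -` P"
      have "g ` Q = P" unfolding Q_def using surj by (rule surj_image_vimage_eq)
      moreover from this P have "Q \<in> points_on U"
        using sub[of Q] dim[of Q] inj_image_subset_iff[OF inj, of Q U]
        by (simp add: points_on_def pg_points_def)
      ultimately show "P \<in> (`) g ` points_on U" by blast
    qed
  qed
  have "(`) g ` pg_points = pg_points"
    using img[of UNIV] unfolding surj points_on_def by simp
  then have "bij_betw ((`) g) pg_points pg_points"
    using inj_im by (auto simp: bij_betw_def intro: inj_on_subset)
  moreover have "pg_line ((`) g ` l)" if "pg_line l" for l
  proof -
    from that obtain U where U: "vec.subspace U" "vec.dim U = 2" "l = points_on U"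
      unfolding pg_line_def by (elim exE conjE)
    have "vec.subspace (g ` U)" "vec.dim (g ` U) = 2" "(`) g ` l = points_on (g ` U)"
      using U by (simp_all only: img sub dim)
    then show ?thesis unfolding pg_line_def by (intro exI conjI)
  qed
  ultimately show ?thesis by (simp add: pg_collineation_def)
qed

text \<open>The linear map taking the standard basis to the family \<open>b\<close>; both coordinate
  systems used later are built from it.\<close>

definition lin_comb :: "('n \<Rightarrow> 'f::field ^ 'n) \<Rightarrow> 'f ^ 'n \<Rightarrow> 'f ^ 'n"
  where "lin_comb b x = (\<Sum>i\<in>UNIV. x $ i *s b i)"

lemma linear_lin_comb: "Vector_Spaces.linear (*s) (*s) (lin_comb b)"
  by unfold_locales
    (simp_all add: lin_comb_def vec.scale_left_distrib sum.distrib vec.scale_sum_right)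

text \<open>The range is a subspace containing every \<open>b i\<close>, hence everything; in finite
  dimension surjectivity gives injectivity.\<close>

lemma bij_lin_comb:
  assumes "vec.span (range b) = UNIV"
  shows "bij (lin_comb b)"
proof -
  interpret L: Vector_Spaces.linear "(*s)" "(*s)" "lin_comb b" by (rule linear_lin_comb)
  have "b i \<in> range (lin_comb b)" for i
  proof -
    have "lin_comb b (axis i 1) = (\<Sum>j\<in>UNIV. if j = i then b i else 0)"
      unfolding lin_comb_def by (rule sum.cong) (auto simp: axis_def)
    then have "lin_comb b (axis i 1) = b i" by simp
    then show ?thesis by (rule range_eqI[OF sym])
  qed
  moreover have "vec.subspace (range (lin_comb b))"
    using L.subspace_image[of UNIV] by simp
  ultimately have surj: "surj (lin_comb b)"
    using assms vec.span_minimal[of "range b" "range (lin_comb b)"] by blast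
  moreover have "inj (lin_comb b)"
    by (rule vec.linear_surjective_imp_injective[OF linear_lin_comb surj]) simp
  ultimately show ?thesis by (simp add: bij_def)
qed

lemma linear_image_span_singleton:
  "Vector_Spaces.linear (*s) (*s) g \<Longrightarrow> g ` vec.span {v} = vec.span {g v}"
  using vec.linear_span_image[of g "{v}"] by simp

text \<open>Since \<open>V\<close> represents each point by one nonzero vector, counting points of a
  hyperplane section amounts to counting zeros of a functional on \<open>V\<close>.\<close>

lemma card_points_on_kernel:
  assumes f: "functional f" and V: "0 \<notin> V" "inj_on (\<lambda>v. vec.span {v}) V"
  shows "card (points_on {x. f x = 0} \<inter> (\<lambda>v. vec.span {v}) ` V) = card {v \<in> V. f v = 0}"
proof -
  have "points_on {x. f x = 0} \<inter> (\<lambda>v. vec.span {v}) ` V = (\<lambda>v. vec.span {v}) ` {v \<in> V. f v = 0}"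
    using V(1) span_singleton_subset_iff[OF subspace_kernel[OF f]]
    by (auto simp: points_on_def)
  moreover have "inj_on (\<lambda>v. vec.span {v}) {v \<in> V. f v = 0}"
    using V(2) by (rule inj_on_subset) auto
  ultimately show ?thesis by (simp add: card_image)
qed

lemma points_representatives:
  assumes "K \<subseteq> pg_points"
  obtains V where "0 \<notin> V" "inj_on (\<lambda>v. vec.span {v}) V" "K = (\<lambda>v. vec.span {v}) ` V"
proof -
  obtain r where r: "\<And>P. P \<in> K \<Longrightarrow> r P \<noteq> 0 \<and> P = vec.span {r P}"
    using assms pg_points_iff by (metis subsetD)
  show ?thesis
  proof (rule that[of "r ` K"])
    show "0 \<notin> r ` K" using r by (metis (no_types, lifting) imageE)
    show "inj_on (\<lambda>v. vec.span {v}) (r ` K)" using r by (metis (no_types, lifting) imageE inj_onI)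
    show "K = (\<lambda>v. vec.span {v}) ` r ` K" using r by (auto simp: image_image)
  qed
qed

subsection \<open>Point sets over \<open>GF(3)\<close> and their hyperplane sections\<close>

locale gf3 =
  fixes field_type :: "'f::field itself"
  assumes card_field: "CARD('f) = 3"
begin

lemma finite_field: "finite (UNIV :: 'f set)"
  using card_field by (metis card.infinite zero_neq_numeral)

text \<open>Otherwise \<open>1 + 1 = 0\<close>, and for any third element \<open>x\<close> the sum
  \<open>x + 1\<close> would be a fourth one.\<close>

lemma minus_one_neq_one: "(-1 :: 'f) \<noteq> 1"
proof
  assume "(-1 :: 'f) = 1"
  then have double: "(1 :: 'f) + 1 = 0"
    by (metis add.right_inverse)
  obtain x :: 'f where x: "x \<noteq> 0" "x \<noteq> 1"
  proof -
    have "\<not> (UNIV :: 'f set) \<subseteq> {0, 1}"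
      using card_mono[of "{0, 1 :: 'f}" UNIV] by (auto simp: card_field)
    then show ?thesis using that by blast
  qed
  have "x + 1 \<noteq> 1 + 1" using x(2) by (simp only: add_right_cancel not_False_eq_True)
  then have "x + 1 \<noteq> 0" "x + 1 \<noteq> 1" "x + 1 \<noteq> x"
    using x(1) unfolding double by simp_all
  then have "card {0, 1, x, x + 1} = 4" using x by auto
  then show False
    using card_mono[OF finite_field, of "{0, 1, x, x + 1}"] by (simp add: card_field)
qed

lemma univ_field: "(UNIV :: 'f set) = {0, 1, -1}"
  by (rule card_subset_eq[symmetric])
    (use minus_one_neq_one in \<open>auto simp: card_field finite_field\<close>)

lemma field_cases:
  obtains "x = (0::'f)" | "x = 1" | "x = -1"
  using univ_field by blast

lemma two_eq: "(2::'f) = -1"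
proof (cases "2 :: 'f" rule: field_cases)
  case 1
  then have "(1::'f) + 1 = 0" by simp
  then have "(-1::'f) = 1" by (rule minus_unique)
  then show ?thesis using minus_one_neq_one by contradiction
next
  case 2
  then have "(1::'f) + 1 = 1 + 0" by simp
  then show ?thesis by (simp only: add_left_cancel) simp
qed

lemma two_neq_zero: "(2::'f) \<noteq> 0"
  by (simp add: two_eq)

lemma three_eq: "(3::'f) = 0"
proof -
  have "(3::'f) = 2 + 1" by simp
  then show ?thesis unfolding two_eq by simp
qed

lemma square_eq_one: "(x::'f) \<noteq> 0 \<Longrightarrow> x * x = 1"
  by (cases x rule: field_cases) simp_all

lemma eq_or_eq_minus: "(x::'f) \<noteq> 0 \<Longrightarrow> y \<noteq> 0 \<Longrightarrow> x = y \<or> x = - y"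
  by (cases x rule: field_cases; cases y rule: field_cases) simp_all

lemma neq_minus_self: "(x::'f) \<noteq> 0 \<Longrightarrow> x \<noteq> - x"
  by (cases x rule: field_cases) (use minus_one_neq_one in auto)

end

text \<open>The numerical core of the design property; for sets of twelve points of the projective
  5-space over GF(3) it is equivalent to it by \<open>design_iff_sextuple_sections\<close>.\<close>

definition sextuple_sections :: "('f::field ^ 'n) set set \<Rightarrow> bool"
  where "sextuple_sections K \<longleftrightarrow> (\<forall>h. pg_hyperplane h \<longrightarrow> card (h \<inter> K) > 3 \<longrightarrow> card (h \<inter> K) = 6)"

lemma design_sextuple_sections:
  assumes "is_design 5 12 6 1 K (hyperplane_blocks K)"
  shows "card K = 12" "sextuple_sections K"
  using assms by (auto simp: is_design_def hyperplane_blocks_def sextuple_sections_def)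

text \<open>Representatives of five points span a subspace of dimension at most 5 in a 6-dimensional
  space, so some nonzero functional vanishes on them.\<close>

lemma hyperplane_through_five:
  fixes T :: "('f::field ^ 6) set set"
  assumes "T \<subseteq> pg_points" "card T = 5"
  shows "\<exists>f w. functional f \<and> f w \<noteq> 0 \<and> T \<subseteq> points_on {x. f x = 0}"
proof -
  obtain V where V: "0 \<notin> V" "inj_on (\<lambda>v. vec.span {v}) V" "T = (\<lambda>v. vec.span {v}) ` V"
    using assms(1) by (rule points_representatives)
  have card: "card V = 5" using V(2,3) assms(2) by (simp add: card_image)
  then have "finite V" by (metis card.infinite zero_neq_numeral)
  then have dim: "vec.dim (vec.span V) \<le> 5"
    using vec.dim_le_card[of V V] card by (simp add: vec.span_superset)
  have "vec.span V \<noteq> UNIV"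
  proof
    assume full: "vec.span V = UNIV"
    show False using dim unfolding full vec_dim_card by simp
  qed
  then obtain f w where f: "functional f" "f w \<noteq> 0" "\<forall>x\<in>V. f x = 0"
    using functional_vanishing_on by blast
  then have "T \<subseteq> points_on {x. f x = 0}"
    using V(1) span_singleton_subset_iff[OF subspace_kernel[OF f(1)]]
    by (auto simp: V(3) points_on_def)
  then show ?thesis using f by blast
qed

context gf3
begin

text \<open>
  If two hyperplanes through the same five points of \<open>K\<close> differ, then each of the four hyperplanes
  of the pencil spanned by them contains exactly one of the remaining seven points, although the
  pencil covers the whole space.
\<close>

lemma hyperplane_through_five_unique:
  fixes f g :: "'f ^ 'n \<Rightarrow> 'f"
  assumes K: "K \<subseteq> pg_points" "card K = 12" "sextuple_sections K"
    and T: "T \<subseteq> K" "card T = 5"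
    and f: "functional f" "T \<subseteq> points_on {x. f x = 0}" "f u \<noteq> 0"
    and g: "functional g" "T \<subseteq> points_on {x. g x = 0}" "g w \<noteq> 0"
  shows "{x. f x = 0} = {x. g x = 0}"
proof (rule ccontr)
  assume neq: "{x. f x = 0} \<noteq> {x. g x = 0}"
  have finK: "finite K" using K(2) by (metis card.infinite zero_neq_numeral)
  then have finT: "finite T" using T(1) finite_subset by blast
  have one: "card ((points_on {x. h x = 0} \<inter> K) - T) = 1"
    if h: "functional h" "T \<subseteq> points_on {x. h x = 0}" "h z \<noteq> 0" for h :: "'f ^ 'n \<Rightarrow> 'f" and z
  proof -
    have sub: "T \<subseteq> points_on {x. h x = 0} \<inter> K" using h(2) T(1) by blast
    then have "card T \<le> card (points_on {x. h x = 0} \<inter> K)"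
      using finK by (simp add: card_mono)
    moreover have "pg_hyperplane (points_on {x. h x = 0})"
      using h pg_hyperplane_iff by blast
    ultimately have "card (points_on {x. h x = 0} \<inter> K) = 6"
      using K(3) T(2) by (simp add: sextuple_sections_def)
    then show ?thesis using sub finT T(2) by (simp add: card_Diff_subset)
  qed
  have sum: "functional (\<lambda>x. f x + g x)" and diff: "functional (\<lambda>x. f x - g x)"
    using f(1) g(1) by (simp_all add: functional_plus functional_minus)
  have through: "T \<subseteq> points_on {x. f x + g x = 0}" "T \<subseteq> points_on {x. f x - g x = 0}"
    using f(2) g(2) by (force simp: points_on_def)+
  \<comment> \<open>Distinct kernels keep \<open>f + g\<close> and \<open>f - g\<close> from
    vanishing identically, so these two also define hyperplanes.\<close>
  obtain z where "f z + g z \<noteq> 0" using neq by (metis (no_types) add_eq_0_iff neg_equal_0_iff_equal)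
  moreover obtain z' where "f z' - g z' \<noteq> 0" using neq by (metis (no_types) right_minus_eq)
  ultimately have cards:
    "card (points_on {x. f x = 0} \<inter> K - T) = 1" "card (points_on {x. g x = 0} \<inter> K - T) = 1"
    "card (points_on {x. f x + g x = 0} \<inter> K - T) = 1"
    "card (points_on {x. f x - g x = 0} \<inter> K - T) = 1"
    using one[OF f] one[OF g] one[OF sum through(1)] one[OF diff through(2)] by blast+
  have "K - T \<subseteq> ((points_on {x. f x = 0} \<inter> K - T) \<union> (points_on {x. g x = 0} \<inter> K - T)) \<union>
    ((points_on {x. f x + g x = 0} \<inter> K - T) \<union> (points_on {x. f x - g x = 0} \<inter> K - T))"
    (is "_ \<subseteq> (?A \<union> ?B) \<union> (?C \<union> ?D)")
  proof
    fix P assume P: "P \<in> K - T"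
    then obtain v where v: "v \<noteq> 0" "P = vec.span {v}" using K(1) pg_points_iff by blast
    have on: "P \<in> points_on {x. h x = 0} \<longleftrightarrow> h v = 0" if "functional h" for h :: "'f ^ 'n \<Rightarrow> 'f"
      using v span_singleton_subset_iff[OF subspace_kernel[OF that]] by (simp add: points_on_def)
    \<comment> \<open>Two nonzero elements of GF(3) are equal or opposite, so four functionals
      exhaust the pencil.\<close>
    have "f v = 0 \<or> g v = 0 \<or> f v + g v = 0 \<or> f v - g v = 0"
      using eq_or_eq_minus[of "f v" "g v"] by auto
    then show "P \<in> (?A \<union> ?B) \<union> (?C \<union> ?D)"
      using P on[OF f(1)] on[OF g(1)] on[OF sum] on[OF diff] by blast
  qed
  moreover have "finite ((?A \<union> ?B) \<union> (?C \<union> ?D))" using finK by simp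
  ultimately have "card (K - T) \<le> card ((?A \<union> ?B) \<union> (?C \<union> ?D))"
    by (rule card_mono[rotated])
  also have "\<dots> \<le> (card ?A + card ?B) + (card ?C + card ?D)"
    by (meson add_mono card_Un_le order_trans)
  also have "\<dots> = 4" using cards by simp
  \<comment> \<open>Seven points of \<open>K\<close> lie outside \<open>T\<close>, but at most four
    are covered.\<close>
  finally show False using K(2) T finT by (simp add: card_Diff_subset)
qed

text \<open>Five points lie in some hyperplane for reasons of dimension, which gives a block; that
  hyperplane is unique by the pencil argument, so the block is too.\<close>

theorem design_iff_sextuple_sections:
  fixes K :: "('f ^ 6) set set"
  assumes K: "K \<subseteq> pg_points"
  shows "is_design 5 12 6 1 K (hyperplane_blocks K) \<longleftrightarrow> card K = 12 \<and> sextuple_sections K"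
proof
  assume "card K = 12 \<and> sextuple_sections K"
  then have card: "card K = 12" and six: "sextuple_sections K" by blast+
  have finK: "finite K" using card by (metis card.infinite zero_neq_numeral)
  have "card {b \<in> hyperplane_blocks K. T \<subseteq> b} = 1" if T: "T \<subseteq> K" "card T = 5" for T
  proof -
    have "T \<subseteq> pg_points" using T(1) K by (rule subset_trans)
    from hyperplane_through_five[OF this T(2)]
    obtain f w where f: "functional f" "f w \<noteq> 0" "T \<subseteq> points_on {x. f x = 0}"
      by (elim exE conjE)
    let ?b = "points_on {x. f x = 0} \<inter> K"
    have "card T \<le> card (points_on {x. f x = 0} \<inter> K)"
      using f(3) T(1) finK by (simp add: card_mono)
    then have "card ?b > 3" using T(2) by simp
    moreover have "pg_hyperplane (points_on {x. f x = 0})"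
      unfolding pg_hyperplane_iff using f(1,2) by (intro exI[of _ f] exI[of _ w]) simp
    ultimately have "?b \<in> hyperplane_blocks K"
      unfolding hyperplane_blocks_def
      by (intro CollectI exI[of _ "points_on {x. f x = 0}"]) simp
    moreover have "T \<subseteq> ?b" using f(3) T(1) by (rule Int_greatest)
    moreover have "b = ?b" if b: "b \<in> hyperplane_blocks K" "T \<subseteq> b" for b
    proof -
      from b(1) obtain h where h: "pg_hyperplane h" "b = h \<inter> K"
        unfolding hyperplane_blocks_def by (elim CollectE exE conjE)
      from h(1) obtain g z where g: "functional g" "g z \<noteq> 0" "h = points_on {x. g x = 0}"
        unfolding pg_hyperplane_iff by (elim exE conjE)
      have "T \<subseteq> points_on {x. g x = 0}" using b(2) unfolding h(2) g(3) by (rule le_infE)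
      then have "{x. f x = 0} = {x. g x = 0}"
        by (rule hyperplane_through_five_unique[OF K card six T f(1,3,2) g(1) _ g(2)])
      then show ?thesis unfolding h(2) g(3) by simp
    qed
    ultimately have "\<exists>!b. b \<in> hyperplane_blocks K \<and> T \<subseteq> b"
      by (intro ex1I[of _ ?b]) (rule conjI, assumption, assumption, elim conjE)
    then obtain b where "{b \<in> hyperplane_blocks K. T \<subseteq> b} = {b}" by blast
    then show ?thesis by simp
  qed
  then show "is_design 5 12 6 1 K (hyperplane_blocks K)"
    using card six finK
    by (auto simp: is_design_def hyperplane_blocks_def sextuple_sections_def)
qed (use design_sextuple_sections in blast)

end

section \<open>Reduction modulo 3 and zero counts of functionals\<close>

context gf3 begin
lemma four_eq: "(4::'f) = 1"
proof -
  have "(4::'f) = 3 + 1" by simp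
  then show ?thesis unfolding three_eq by simp
qed

lemma five_eq: "(5::'f) = -1"
proof -
  have "(5::'f) = 3 + 2" by simp
  then show ?thesis unfolding three_eq two_eq by simp
qed

lemma six_eq: "(6::'f) = 0"
proof -
  have "(6::'f) = 3 + 3" by simp
  then show ?thesis unfolding three_eq by simp
qed

text \<open>
  The twelve summands are the values of a functional with coefficients \<open>a, \<dots>, g\<close> at the vectors
  \<open>witt_vectors\<close> below.
\<close>

lemma count_zeros:
  fixes a b c d e g :: 'f
  defines "N \<equiv> of_bool (g = 0) + of_bool (d - e + g = 0) + of_bool (d + e + g = 0)
    + of_bool (a - c + g = 0) + of_bool (a - b - c + d - e + g = 0) + of_bool (a + b - c + d + e + g = 0)
    + of_bool (a + c + g = 0) + of_bool (a + b + c + d - e + g = 0) + of_bool (a - b + c + d + e + g = 0)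
    + of_bool (a + d = 0) + of_bool (a + b - d = 0) + of_bool (a - b - d = (0::'f)) :: nat"
  shows "(a = 0 \<and> b = 0 \<and> c = 0 \<and> d = 0 \<and> e = 0 \<and> g = 0) \<or> N \<le> 3 \<or> N = 6"
  unfolding N_def
  \<comment> \<open>All 729 coefficient vectors are checked; the reduced numerals decide which of
    the twelve sums vanish.\<close>
  by (cases a rule: field_cases; cases b rule: field_cases; cases d rule: field_cases;
      cases c rule: field_cases; cases e rule: field_cases; cases g rule: field_cases;
      simp add: two_eq three_eq four_eq five_eq six_eq minus_one_neq_one minus_one_neq_one[symmetric])

end

text \<open>The form in which the condition is verified for \<open>witt_vectors\<close> and
  exploited in the uniqueness proof.\<close>

lemma sextuple_sections_span_image:
  fixes V :: "('f::field ^ 'n) set"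
  assumes V: "0 \<notin> V" "inj_on (\<lambda>v. vec.span {v}) V"
  shows "sextuple_sections ((\<lambda>v. vec.span {v}) ` V) \<longleftrightarrow>
    (\<forall>f w. functional f \<longrightarrow> f w \<noteq> 0 \<longrightarrow> card {v \<in> V. f v = 0} > 3 \<longrightarrow> card {v \<in> V. f v = 0} = 6)"
  unfolding sextuple_sections_def
proof (intro iffI allI impI)
  fix f w
  assume all: "\<forall>h. pg_hyperplane h \<longrightarrow> 3 < card (h \<inter> (\<lambda>v. vec.span {v}) ` V) \<longrightarrow>
      card (h \<inter> (\<lambda>v. vec.span {v}) ` V) = 6"
    and f: "functional f" "f w \<noteq> 0" and c: "3 < card {v \<in> V. f v = 0}"
  have "pg_hyperplane (points_on {x. f x = 0})"
    unfolding pg_hyperplane_iff using f by (intro exI[of _ f] exI[of _ w]) simp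
  from all[rule_format, OF this] show "card {v \<in> V. f v = 0} = 6"
    using c unfolding card_points_on_kernel[OF f(1) V] .
next
  fix h
  assume all: "\<forall>f w. functional f \<longrightarrow> f w \<noteq> 0 \<longrightarrow> card {v \<in> V. f v = 0} > 3 \<longrightarrow>
      card {v \<in> V. f v = 0} = 6"
    and h: "pg_hyperplane h" and c: "3 < card (h \<inter> (\<lambda>v. vec.span {v}) ` V)"
  from h obtain f w where f: "functional f" "f w \<noteq> 0" "h = points_on {x. f x = 0}"
    unfolding pg_hyperplane_iff by (elim exE conjE)
  show "card (h \<inter> (\<lambda>v. vec.span {v}) ` V) = 6"
    using all[rule_format, OF f(1,2)] c unfolding f(3) card_points_on_kernel[OF f(1) V] .
qed

section \<open>Coordinates on the symmetric square\<close>

lemma UNIV_6: "(UNIV :: 6 set) = {1, 2, 3, 4, 5, 6}"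
  using exhaust_6 by auto

lemma sum_6: "sum f (UNIV :: 6 set) = f 1 + f 2 + f 3 + f 4 + f 5 + f 6"
  unfolding UNIV_6 by (simp add: ac_simps)

lemma functional_expansion_6:
  fixes f :: "'f::field ^ 6 \<Rightarrow> 'f"
  assumes "functional f"
  shows "f x = x $ 1 * f (axis 1 1) + x $ 2 * f (axis 2 1) + x $ 3 * f (axis 3 1)
    + x $ 4 * f (axis 4 1) + x $ 5 * f (axis 5 1) + x $ 6 * f (axis 6 1)"
proof -
  have "x = (\<Sum>i\<in>UNIV. x $ i *s axis i 1)" by (simp add: basis_expansion)
  then have "f x = f (\<Sum>i\<in>UNIV. x $ i *s axis i 1)" by (rule arg_cong)
  also have "\<dots> = (\<Sum>i\<in>UNIV. x $ i * f (axis i 1))"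
    by (simp add: functional_sum[OF assms] functional_scale[OF assms])
  finally show ?thesis unfolding sum_6 .
qed

lemma sym_prod_add_right: "sym_prod a (b + c) = sym_prod a b + sym_prod a c"
  using linear_sym_prod[of a] by (simp add: Vector_Spaces.linear_iff)

lemma sym_prod_scale_right: "sym_prod a (k *s b) = k *s sym_prod a b"
  using linear_sym_prod[of a] by (simp add: Vector_Spaces.linear_iff)

lemma sym_prod_add_left: "sym_prod (a + b) c = sym_prod a c + sym_prod b c"
  by (simp add: sym_prod_commute[of _ c] sym_prod_add_right)

lemma sym_prod_scale_left: "sym_prod (k *s a) b = k *s sym_prod a b"
  by (simp add: sym_prod_commute[of _ b] sym_prod_scale_right)

text \<open>The mixed products are taken without the factor 2 of the standard coordinates; over
  GF(3) this accounts for the minus signs in \<open>sym_prod_square\<close>.\<close>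

definition sym_coords :: "'f::field ^ 3 \<Rightarrow> 'f ^ 3 \<Rightarrow> 'f ^ 3 \<Rightarrow> 'f ^ 6 \<Rightarrow> 'f ^ 6"
  where "sym_coords u v w = lin_comb (($) (vector [sym_prod u u, sym_prod u v, sym_prod u w,
    sym_prod v v, sym_prod v w, sym_prod w w]))"

lemma sym_coords_eq: "sym_coords u v w x =
    x $ 1 *s sym_prod u u + x $ 2 *s sym_prod u v + x $ 3 *s sym_prod u w
    + x $ 4 *s sym_prod v v + x $ 5 *s sym_prod v w + x $ 6 *s sym_prod w w"
  by (simp add: sym_coords_def lin_comb_def sum_6)

lemma linear_sym_coords: "Vector_Spaces.linear (*s) (*s) (sym_coords u v w)"
  unfolding sym_coords_def by (rule linear_lin_comb)

text \<open>The preimage of \<open>S\<close> under the linear map \<open>sym_prod a\<close> is a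
  subspace containing a spanning set. Used for one argument after the other, this extends membership
  from generators to all products.\<close>

lemma sym_prod_in_subspace:
  assumes S: "vec.subspace S" and span: "vec.span B = UNIV" and B: "\<And>b. b \<in> B \<Longrightarrow> sym_prod a b \<in> S"
  shows "sym_prod a c \<in> S"
proof -
  have "B \<subseteq> sym_prod a -` S" using B by blast
  moreover have "vec.subspace (sym_prod a -` S)"
    by (rule vec.linear_subspace_vimage[OF linear_sym_prod S])
  ultimately have "vec.span B \<subseteq> sym_prod a -` S" by (rule vec.span_minimal)
  then show ?thesis unfolding span by blast
qed

text \<open>The six products span all symmetric products by bilinearity, and these span the whole
  space: the unit vectors are \<open>sym_prod\<close> of standard basis vectors, doubled in the
  mixed positions.\<close>

lemma bij_sym_coords:
  fixes u v w :: "'f::field ^ 3"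
  assumes two: "(2::'f) \<noteq> 0" and span: "vec.span {u, v, w} = UNIV"
  shows "bij (sym_coords u v w)"
  unfolding sym_coords_def
proof (rule bij_lin_comb)
  let ?b = "($) (vector [sym_prod u u, sym_prod u v, sym_prod u w,
    sym_prod v v, sym_prod v w, sym_prod w w] :: 'f ^ 6 ^ 6)"
  let ?S = "vec.span (range ?b)"
  have S: "vec.subspace ?S" by simp
  have b: "?b i \<in> ?S" for i by (rule vec.span_base) simp
  have base: "sym_prod x y \<in> ?S" if "x \<in> {u, v, w}" "y \<in> {u, v, w}" for x y
    using that b[of 1] b[of 2] b[of 3] b[of 4] b[of 5] b[of 6]
    by (auto simp: sym_prod_commute[of v u] sym_prod_commute[of w u] sym_prod_commute[of w v])
  have half: "sym_prod x y \<in> ?S" if "x \<in> {u, v, w}" for x y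
    using S span base[OF that] by (rule sym_prod_in_subspace)
  have all: "sym_prod x y \<in> ?S" for x y
    using S span by (rule sym_prod_in_subspace) (subst sym_prod_commute, rule half)
  have "z \<in> ?S" for z
  proof -
    let ?e = "\<lambda>i. axis i 1 :: 'f ^ 3"
    have "z = z $ 1 *s sym_prod (?e 1) (?e 1) + (2 * z $ 2) *s sym_prod (?e 1) (?e 2)
        + (2 * z $ 3) *s sym_prod (?e 1) (?e 3) + z $ 4 *s sym_prod (?e 2) (?e 2)
        + (2 * z $ 5) *s sym_prod (?e 2) (?e 3) + z $ 6 *s sym_prod (?e 3) (?e 3)"
      using two by (simp add: vec_eq_iff forall_6 sym_prod_def axis_def)
    also have "\<dots> \<in> ?S"
      by (intro vec.span_add vec.span_scale all)
    finally show ?thesis .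
  qed
  then show "?S = UNIV" by blast
qed

text \<open>
  The coordinates of the points of \<open>\<K>\<close> when \<open>l\<^sub>\<infinity>\<close> is spanned by \<open>u\<close> and \<open>v\<close>: the squares of the
  vectors \<open>\<alpha> u + \<beta> v + w\<close> (note that \<open>2 = -1\<close>), followed by the three diagonal points.
\<close>

definition witt_vectors :: "('f::field ^ 6) set"
  where "witt_vectors = {
    vector [0, 0, 0, 0, 0, 1], vector [0, 0, 0, 1, -1, 1], vector [0, 0, 0, 1, 1, 1],
    vector [1, 0, -1, 0, 0, 1], vector [1, -1, -1, 1, -1, 1], vector [1, 1, -1, 1, 1, 1],
    vector [1, 0, 1, 0, 0, 1], vector [1, 1, 1, 1, -1, 1], vector [1, -1, 1, 1, 1, 1],
    vector [1, 0, 0, 1, 0, 0], vector [1, 1, 0, -1, 0, 0], vector [1, -1, 0, -1, 0, 0]}"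

lemma finite_witt_vectors: "finite witt_vectors"
  by (simp add: witt_vectors_def)

text \<open>This normalisation makes proportional members of \<open>witt_vectors\<close> equal, so
  that they represent different points.\<close>

lemma witt_vectors_normalized: "x \<in> witt_vectors \<Longrightarrow> x $ 6 = 1 \<or> x $ 6 = 0 \<and> x $ 1 = 1"
  by (auto simp: witt_vectors_def)

lemma witt_vectors_nonzero: "0 \<notin> witt_vectors"
  using witt_vectors_normalized[of 0] by auto

context gf3
begin

text \<open>The content is that the twelve listed vectors are distinct. The constant 1 yields the
  cardinality, the indicator of a kernel the number of zeros.\<close>

lemma sum_witt_vectors:
  fixes h :: "'f ^ 6 \<Rightarrow> nat"
  shows "(\<Sum>x\<in>witt_vectors. h x) =
    h (vector [0, 0, 0, 0, 0, 1]) + h (vector [0, 0, 0, 1, -1, 1]) + h (vector [0, 0, 0, 1, 1, 1])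
    + h (vector [1, 0, -1, 0, 0, 1]) + h (vector [1, -1, -1, 1, -1, 1]) + h (vector [1, 1, -1, 1, 1, 1])
    + h (vector [1, 0, 1, 0, 0, 1]) + h (vector [1, 1, 1, 1, -1, 1]) + h (vector [1, -1, 1, 1, 1, 1])
    + h (vector [1, 0, 0, 1, 0, 0]) + h (vector [1, 1, 0, -1, 0, 0]) + h (vector [1, -1, 0, -1, 0, 0])"
  unfolding witt_vectors_def
  by (simp add: vec_eq_iff forall_6 minus_one_neq_one minus_one_neq_one[symmetric])

lemma card_witt_vectors: "card (witt_vectors :: ('f ^ 6) set) = 12"
  using sum_witt_vectors[of "\<lambda>_. 1"] by simp

text \<open>Written as a sum of truth values, the number of zeros is the quantity \<open>N\<close>
  of \<open>count_zeros\<close>, evaluated at the coefficients of \<open>f\<close>.\<close>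

lemma witt_vectors_sections:
  fixes f :: "'f ^ 6 \<Rightarrow> 'f"
  assumes f: "functional f" "f z \<noteq> 0" and c: "card {x \<in> witt_vectors. f x = 0} > 3"
  shows "card {x \<in> witt_vectors. f x = 0} = 6"
proof -
  note ex = functional_expansion_6[OF f(1)]
  define a b c d e g where coeffs: "a = f (axis 1 1)" "b = f (axis 2 1)" "c = f (axis 3 1)"
    "d = f (axis 4 1)" "e = f (axis 5 1)" "g = f (axis 6 1)"
  have f_vector: "f (vector [x1, x2, x3, x4, x5, x6])
      = x1 * a + x2 * b + x3 * c + x4 * d + x5 * e + x6 * g" for x1 x2 x3 x4 x5 x6
    by (simp add: ex[of "vector [x1, x2, x3, x4, x5, x6]"] coeffs)
  have nonzero: "\<not> (a = 0 \<and> b = 0 \<and> c = 0 \<and> d = 0 \<and> e = 0 \<and> g = 0)"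
    using f(2) ex[of z] by (auto simp: coeffs)
  have "card {x \<in> witt_vectors. f x = 0} = (\<Sum>x\<in>witt_vectors. of_bool (f x = 0))"
    by (simp add: finite_witt_vectors Int_def)
  also have "\<dots> \<le> 3 \<or> \<dots> = 6"
    using count_zeros[of a b c d e g] nonzero
    unfolding sum_witt_vectors f_vector by simp
  finally show ?thesis using c by linarith
qed

end

subsection \<open>The coordinates of the point set \<open>\<K>\<close>\<close>

text \<open>The definition ranges over all labellings of the quadrangle, but the meeting point
  depends only on the splitting into two pairs, of which there are three.\<close>

lemma diagonal_triangle_eq:
  assumes dist: "card {A, B, C, D} = 4"
    and r: "join_line A B \<inter> join_line C D = {R1}" "join_line A C \<inter> join_line B D = {R2}"
      "join_line A D \<inter> join_line B C = {R3}"
  shows "diagonal_triangle {A, B, C, D} = {R1, R2, R3}"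
proof
  have neq: "A \<noteq> B" "A \<noteq> C" "A \<noteq> D" "B \<noteq> C" "B \<noteq> D" "C \<noteq> D"
    using dist by (auto simp: card_insert_if split: if_splits)
  \<comment> \<open>Taking a set of points as argument makes the line independent of the order of
    the two points.\<close>
  define line where "line S = points_on (vec.span (\<Union>S))" for S :: "('a ^ 'b) set set"
  have join: "join_line X Y = line {X, Y}" for X Y by (simp add: join_line_def line_def)
  note lines = r[unfolded join]
  show "diagonal_triangle {A, B, C, D} \<subseteq> {R1, R2, R3}"
  proof
    fix P assume "P \<in> diagonal_triangle {A, B, C, D}"
    then obtain A' B' C' D' where e: "{A, B, C, D} = {A', B', C', D'}" "card {A', B', C', D'} = 4"
      "join_line A' B' \<inter> join_line C' D' = {P}"
      unfolding diagonal_triangle_def by (elim CollectE exE conjE)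
    have neq': "A' \<noteq> B'" "A' \<noteq> C'" "A' \<noteq> D'" "B' \<noteq> C'" "B' \<noteq> D'" "C' \<noteq> D'"
      using e(2) by (auto simp: card_insert_if split: if_splits)
    then have "{C', D'} = {A', B', C', D'} - {A', B'}" by auto
    then have P: "line {A', B'} \<inter> line ({A, B, C, D} - {A', B'}) = {P}"
      using e(3) unfolding e(1) join by simp
    have "A' \<in> {A, B, C, D}" "B' \<in> {A, B, C, D}" unfolding e(1) by simp_all
    then have "{P} = {R1} \<or> {P} = {R2} \<or> {P} = {R3}"
      unfolding P[symmetric] lines[symmetric] using neq'(1)
      by (elim insertE emptyE)
        (simp_all add: neq neq[symmetric] insert_Diff_if insert_commute Int_commute)
    then show "P \<in> {R1, R2, R3}" by blast
  qed
  have "card {A, C, B, D} = 4" "card {A, D, B, C} = 4" using neq by simp_all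
  moreover have "{A, B, C, D} = {A, C, B, D}" "{A, B, C, D} = {A, D, B, C}" by auto
  ultimately have "R1 \<in> diagonal_triangle {A, B, C, D}" "R2 \<in> diagonal_triangle {A, B, C, D}"
    "R3 \<in> diagonal_triangle {A, B, C, D}"
    unfolding diagonal_triangle_def using r dist by (blast, metis (mono_tags, lifting) mem_Collect_eq, metis (mono_tags, lifting) mem_Collect_eq)
  then show "{R1, R2, R3} \<subseteq> diagonal_triangle {A, B, C, D}" by simp
qed

lemma span_pair: "vec.span {a, b} = {x. \<exists>\<alpha> \<beta>. x = \<alpha> *s a + \<beta> *s b}"
proof -
  have "x - \<alpha> *s a = \<beta> *s b \<longleftrightarrow> x = \<alpha> *s a + \<beta> *s b" for x \<alpha> \<beta>
    by (auto simp: algebra_simps)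
  then show ?thesis by (simp add: vec.span_insert[of a "{b}"] vec.span_singleton image_iff)
qed

text \<open>Injective linear maps commute with spans and intersections, so diagonal points can be
  computed before \<open>L\<close> is applied.\<close>

lemma join_lines_linear_image:
  fixes L :: "'f::field ^ 'n \<Rightarrow> 'f ^ 'n"
  assumes L: "Vector_Spaces.linear (*s) (*s) L" "inj L"
    and p: "vec.span {a, b} \<inter> vec.span {c, d} = vec.span {p}" "p \<noteq> 0"
  shows "join_line (vec.span {L a}) (vec.span {L b}) \<inter> join_line (vec.span {L c}) (vec.span {L d})
    = {vec.span {L p}}"
proof -
  have im: "vec.span {L x, L y} = L ` vec.span {x, y}" for x y
    using vec.linear_span_image[OF L(1), of "{x, y}"] by simp
  have "L p \<noteq> L 0" using p(2) L(2) by (simp add: inj_eq)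
  then have "L p \<noteq> 0" using vec.linear_0[OF L(1)] by simp
  then have "points_on (L ` vec.span {p}) = {vec.span {L p}}"
    unfolding linear_image_span_singleton[OF L(1)] by (rule points_on_span_singleton)
  then show ?thesis
    unfolding join_line_span points_on_Int im image_Int[OF L(2), symmetric] p(1) .
qed

lemma inj_linear_span_eqD:
  assumes L: "Vector_Spaces.linear (*s) (*s) L" "inj L"
    and eq: "vec.span {L x} = vec.span {L y}" and x: "x \<noteq> 0"
  shows "\<exists>c. x = c *s y"
proof -
  have "L ` vec.span {x} = L ` vec.span {y}"
    using eq unfolding linear_image_span_singleton[OF L(1)] .
  then have "vec.span {x} = vec.span {y}" using L(2) by (simp add: inj_image_eq_iff)
  then show ?thesis using span_singleton_eq_iff[OF x] by simp
qed

context gf3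
begin

text \<open>The case \<open>\<gamma> = 1\<close> of \<open>sym_prod_square\<close>: the points off
  the line have such coordinates.\<close>

definition affine_square :: "'f \<Rightarrow> 'f \<Rightarrow> 'f ^ 6"
  where "affine_square \<alpha> \<beta> = vector [\<alpha> * \<alpha>, - (\<alpha> * \<beta>), - \<alpha>, \<beta> * \<beta>, - \<beta>, 1]"

lemma witt_vectors_eq: "(witt_vectors :: ('f ^ 6) set) = {affine_square \<alpha> \<beta> |\<alpha> \<beta>. True} \<union>
  {vector [1, 0, 0, 1, 0, 0], vector [1, -1, 0, -1, 0, 0], vector [1, 1, 0, -1, 0, 0]}"
proof -
  have "{affine_square \<alpha> \<beta> |\<alpha> \<beta>. True} = (\<lambda>(\<alpha>, \<beta>). affine_square \<alpha> \<beta>) ` (UNIV \<times> UNIV)"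
    by auto
  then show ?thesis
    unfolding witt_vectors_def univ_field by (simp add: affine_square_def insert_commute)
qed

text \<open>In the bilinear expansion each mixed product occurs twice, and doubling is negation in
  GF(3).\<close>

lemma sym_prod_square:
  fixes u v w :: "'f ^ 3"
  defines "a \<alpha> \<beta> \<gamma> \<equiv> \<alpha> *s u + \<beta> *s v + \<gamma> *s w"
  shows "sym_prod (a \<alpha> \<beta> \<gamma>) (a \<alpha> \<beta> \<gamma>) = sym_coords u v w
    (vector [\<alpha> * \<alpha>, - (\<alpha> * \<beta>), - (\<alpha> * \<gamma>), \<beta> * \<beta>, - (\<beta> * \<gamma>), \<gamma> * \<gamma>])"
proof -
  have double: "x *s z + x *s z = (- x) *s z" for x :: 'f and z :: "'f ^ 6"
  proof -
    have "x *s z + x *s z = (2 * x) *s z" by (simp add: vec.scale_left_distrib[symmetric])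
    then show ?thesis unfolding two_eq by simp
  qed
  have "sym_prod (a \<alpha> \<beta> \<gamma>) (a \<alpha> \<beta> \<gamma>) = (\<alpha> * \<alpha>) *s sym_prod u u
     + ((\<alpha> * \<beta>) *s sym_prod u v + (\<alpha> * \<beta>) *s sym_prod u v)
     + ((\<alpha> * \<gamma>) *s sym_prod u w + (\<alpha> * \<gamma>) *s sym_prod u w) + (\<beta> * \<beta>) *s sym_prod v v
     + ((\<beta> * \<gamma>) *s sym_prod v w + (\<beta> * \<gamma>) *s sym_prod v w) + (\<gamma> * \<gamma>) *s sym_prod w w"
    by (simp add: a_def sym_prod_add_left sym_prod_add_right sym_prod_scale_left
        sym_prod_scale_right sym_prod_commute[of v u] sym_prod_commute[of w u]
        sym_prod_commute[of w v] vec.scale_right_distrib mult.commute add_ac)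
  then show ?thesis unfolding sym_coords_eq vector_6 double .
qed

lemma veronese_span_square:
  fixes a :: "'f ^ 3"
  shows "veronese (vec.span {a}) = vec.span {sym_prod a a}"
  using veronese_span[OF two_neq_zero] sym_prod_same[OF two_neq_zero] by metis

text \<open>The line is spanned by \<open>u\<close> and \<open>v\<close>, and \<open>w\<close>
  completes them to a basis. Points off the line are normalised to \<open>w\<close>-coordinate 1;
  the image of the line is an explicit quadrangle whose diagonal points are computed.\<close>

theorem witt_points_coordinates:
  fixes l :: "('f ^ 3) set set"
  assumes "pg_line l"
  shows "\<exists>L. Vector_Spaces.linear (*s) (*s) L \<and> bij L \<and>
    witt_points l = (\<lambda>v. vec.span {v}) ` L ` witt_vectors"
proof -
  obtain U where U: "vec.subspace U" "vec.dim U = 2" "l = points_on U"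
    using assms unfolding pg_line_def by (elim exE conjE)
  obtain B where B: "B \<subseteq> U" "vec.independent B" "U \<subseteq> vec.span B" "card B = 2"
    using vec.basis_exists[of U] unfolding U(2) by blast
  from B(4) obtain u v where uv: "B = {u, v}" by (auto simp: card_2_iff)
  have spanU: "vec.span {u, v} = U"
    using B(1,3) uv vec.span_minimal[OF _ U(1)] by blast
  have "U \<noteq> UNIV"
  proof
    assume full: "U = UNIV"
    show False using U(2) unfolding full vec_dim_card by simp
  qed
  then obtain w where w: "w \<notin> U" by blast
  have "vec.dim (insert w {u, v}) = 3"
    using w U(2) spanU vec.dim_span[of "{u, v}"] by (simp add: vec.dim_insert)
  then have "vec.dim (insert w {u, v}) = vec.dim (UNIV :: ('f ^ 3) set)"
    unfolding vec_dim_card by simp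
  then have "vec.span (insert w {u, v}) = UNIV"
    using vec.dim_eq_span[of "insert w {u, v}" UNIV] by simp
  then have span: "vec.span {u, v, w} = UNIV" by (simp add: insert_commute)
  define L where "L = sym_coords u v w"
  have L: "Vector_Spaces.linear (*s) (*s) L" unfolding L_def by (rule linear_sym_coords)
  have bij: "bij L" unfolding L_def by (rule bij_sym_coords[OF two_neq_zero span])
  then have inj: "inj L" by (simp add: bij_def)
  have L0: "L 0 = 0" by (rule vec.linear_0[OF L])
  define pt where "pt x = vec.span {L x}" for x
  define a where "a \<alpha> \<beta> \<gamma> = \<alpha> *s u + \<beta> *s v + \<gamma> *s w" for \<alpha> \<beta> \<gamma>
  have ver: "veronese (vec.span {a \<alpha> \<beta> \<gamma>}) =
      pt (vector [\<alpha> * \<alpha>, - (\<alpha> * \<beta>), - (\<alpha> * \<gamma>), \<beta> * \<beta>, - (\<beta> * \<gamma>), \<gamma> * \<gamma>])" for \<alpha> \<beta> \<gamma>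
    unfolding veronese_span_square a_def sym_prod_square pt_def L_def ..
  \<comment> \<open>Independence of \<open>u\<close>, \<open>v\<close>, \<open>w\<close> is read off
    from the injectivity of \<open>L\<close>: the square of a zero combination has coordinates
    \<alpha>^2, \<beta>^2, \<gamma>^2 equal to 0.\<close>
  have nonzero: "a \<alpha> \<beta> \<gamma> \<noteq> 0" if "\<alpha> \<noteq> 0 \<or> \<beta> \<noteq> 0 \<or> \<gamma> \<noteq> 0" for \<alpha> \<beta> \<gamma>
  proof
    assume "a \<alpha> \<beta> \<gamma> = 0"
    moreover have "sym_prod (0 :: 'f ^ 3) 0 = 0" by (simp add: sym_prod_def vec_eq_iff forall_6)
    ultimately have "L (vector [\<alpha> * \<alpha>, - (\<alpha> * \<beta>), - (\<alpha> * \<gamma>), \<beta> * \<beta>, - (\<beta> * \<gamma>), \<gamma> * \<gamma>]) = L 0"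
      unfolding L0 unfolding L_def sym_prod_square[symmetric] a_def by simp
    then have "vector [\<alpha> * \<alpha>, - (\<alpha> * \<beta>), - (\<alpha> * \<gamma>), \<beta> * \<beta>, - (\<beta> * \<gamma>), \<gamma> * \<gamma>] = (0 :: 'f ^ 6)"
      using inj by (simp add: inj_eq)
    then show False using that by (simp add: vec_eq_iff forall_6)
  qed
  have decompose: "\<exists>\<alpha> \<beta> \<gamma>. z = a \<alpha> \<beta> \<gamma>" for z
  proof -
    have "z \<in> vec.span (insert w {u, v})" using span by (simp add: insert_commute)
    then obtain \<gamma> where "z - \<gamma> *s w \<in> vec.span {u, v}" unfolding vec.span_insert by blast
    then obtain \<alpha> \<beta> where "z - \<gamma> *s w = \<alpha> *s u + \<beta> *s v" unfolding span_pair by blast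
    then have "z = a \<alpha> \<beta> \<gamma>" by (simp add: a_def diff_eq_eq)
    then show ?thesis by blast
  qed
  have inU: "a \<alpha> \<beta> 0 \<in> U" for \<alpha> \<beta>
    unfolding spanU[symmetric] span_pair a_def by auto

  \<comment> \<open>Coordinates of the squares of \<open>u\<close>, \<open>v\<close>,
    \<open>u - v\<close> and \<open>u + v\<close>, in this order.\<close>
  let ?A = "vector [1, 0, 0, 0, 0, 0] :: 'f ^ 6" and ?B = "vector [0, 0, 0, 1, 0, 0] :: 'f ^ 6"
  let ?C = "vector [1, 1, 0, 1, 0, 0] :: 'f ^ 6" and ?D = "vector [1, -1, 0, 1, 0, 0] :: 'f ^ 6"
  have l_eq: "l = {vec.span {a \<alpha> \<beta> 0} |\<alpha> \<beta>. \<alpha> \<noteq> 0 \<or> \<beta> \<noteq> 0}"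
  proof (intro equalityI subsetI)
    fix P assume "P \<in> l"
    then have P: "P \<in> pg_points" "P \<subseteq> U" by (simp_all add: U(3) points_on_def)
    from P(1) obtain z where z: "z \<noteq> 0" "P = vec.span {z}" unfolding pg_points_iff by blast
    have "z \<in> U" using P(2) unfolding z(2) span_singleton_subset_iff[OF U(1)] .
    then obtain \<alpha> \<beta> where ab: "z = \<alpha> *s u + \<beta> *s v"
      unfolding spanU[symmetric] span_pair by blast
    then have "\<alpha> \<noteq> 0 \<or> \<beta> \<noteq> 0" using z(1) by auto
    moreover have "z = a \<alpha> \<beta> 0" using ab by (simp add: a_def)
    ultimately show "P \<in> {vec.span {a \<alpha> \<beta> 0} |\<alpha> \<beta>. \<alpha> \<noteq> 0 \<or> \<beta> \<noteq> 0}" using z(2) by blast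
  next
    fix P assume "P \<in> {vec.span {a \<alpha> \<beta> 0} |\<alpha> \<beta>. \<alpha> \<noteq> 0 \<or> \<beta> \<noteq> 0}"
    then obtain \<alpha> \<beta> where P: "P = vec.span {a \<alpha> \<beta> 0}" "\<alpha> \<noteq> 0 \<or> \<beta> \<noteq> 0" by blast
    then show "P \<in> l"
      using nonzero[of \<alpha> \<beta> 0] inU[of \<alpha> \<beta>] by (simp add: U(3) points_on_def span_singleton_subset_iff[OF U(1)])
  qed
  have image_l: "veronese ` l = {pt ?A, pt ?B, pt ?C, pt ?D}"
  proof -
    have "veronese ` l = (\<lambda>(\<alpha>, \<beta>). veronese (vec.span {a \<alpha> \<beta> 0})) `
        {p \<in> UNIV \<times> UNIV. fst p \<noteq> 0 \<or> snd p \<noteq> 0}"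
      unfolding l_eq by force
    \<comment> \<open>A pair and its negative have the same square, so these eight pairs yield only
      four points.\<close>
    also have "{p \<in> UNIV \<times> UNIV. fst p \<noteq> (0::'f) \<or> snd p \<noteq> (0::'f)} =
        {(0, 1), (0, -1), (1, 0), (-1, 0), (1, 1), (1, -1), (-1, 1), (-1, -1)}"
    proof (rule set_eqI)
      fix p :: "'f \<times> 'f"
      show "p \<in> {p \<in> UNIV \<times> UNIV. fst p \<noteq> 0 \<or> snd p \<noteq> 0} \<longleftrightarrow>
          p \<in> {(0, 1), (0, -1), (1, 0), (-1, 0), (1, 1), (1, -1), (-1, 1), (-1, -1)}"
        by (cases p; cases "fst p" rule: field_cases; cases "snd p" rule: field_cases) simp_all
    qed
    finally show ?thesis by (simp add: ver insert_commute)
  qed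
  have affine: "veronese ` pg_points - veronese ` l = pt ` {affine_square \<alpha> \<beta> |\<alpha> \<beta>. True}"
  proof (intro equalityI subsetI)
    fix Q assume Q: "Q \<in> veronese ` pg_points - veronese ` l"
    then obtain P where P: "P \<in> pg_points" "Q = veronese P" by blast
    from P(1) obtain z where z: "z \<noteq> 0" "P = vec.span {z}" unfolding pg_points_iff by blast
    from decompose obtain \<alpha> \<beta> \<gamma> where abc: "z = a \<alpha> \<beta> \<gamma>" by blast
    have "\<gamma> \<noteq> 0"
    proof
      assume g: "\<gamma> = 0"
      have "P \<in> l"
        using P(1) inU[of \<alpha> \<beta>] unfolding abc g z(2) U(3)
        by (simp add: points_on_def span_singleton_subset_iff[OF U(1)])
      then show False using Q P(2) by blast
    qed
    then have "P = vec.span {inverse \<gamma> *s z}" unfolding z(2) by (simp add: span_scaled)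
    also have "inverse \<gamma> *s z = a (inverse \<gamma> * \<alpha>) (inverse \<gamma> * \<beta>) 1"
      using \<open>\<gamma> \<noteq> 0\<close> by (simp add: abc a_def vec.scale_right_distrib)
    finally have "Q = pt (affine_square (inverse \<gamma> * \<alpha>) (inverse \<gamma> * \<beta>))"
      unfolding P(2) by (simp add: ver affine_square_def)
    then show "Q \<in> pt ` {affine_square \<alpha> \<beta> |\<alpha> \<beta>. True}" by blast
  next
    fix Q assume "Q \<in> pt ` {affine_square \<alpha> \<beta> |\<alpha> \<beta>. True}"
    then obtain \<alpha> \<beta> where Q: "Q = pt (affine_square \<alpha> \<beta>)" by blast
    have "Q = veronese (vec.span {a \<alpha> \<beta> 1})" unfolding ver Q affine_square_def by simp
    then have "Q \<in> veronese ` pg_points" using nonzero[of \<alpha> \<beta> 1] by simp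
    \<comment> \<open>The sixth coordinate separates: it is 0 for the four points of the quadrangle
      and 1 for an affine square.\<close>
    moreover have "Q \<noteq> pt y" if "y $ 6 = 0" for y
    proof
      assume "Q = pt y"
      moreover have six: "affine_square \<alpha> \<beta> $ 6 = 1" by (simp add: affine_square_def)
      moreover from six have "affine_square \<alpha> \<beta> \<noteq> 0" by (metis zero_index zero_neq_one)
      ultimately obtain c where "affine_square \<alpha> \<beta> = c *s y"
        using inj_linear_span_eqD[OF L inj] unfolding Q pt_def by blast
      with six that show False by simp
    qed
    ultimately show "Q \<in> veronese ` pg_points - veronese ` l"
      unfolding image_l by simp
  qed
  have pt_neq: "pt x \<noteq> pt y" if "x \<noteq> 0" "\<And>c. x \<noteq> c *s y" for x y
    using inj_linear_span_eqD[OF L inj, of x y] that unfolding pt_def by blast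
  have distinct: "pt ?A \<noteq> pt ?B" "pt ?A \<noteq> pt ?C" "pt ?A \<noteq> pt ?D" "pt ?B \<noteq> pt ?C" "pt ?B \<noteq> pt ?D"
      "pt ?C \<noteq> pt ?D"
    by (rule pt_neq; use minus_one_neq_one in \<open>auto simp: vec_eq_iff forall_6\<close>)+
  then have card: "card {pt ?A, pt ?B, pt ?C, pt ?D} = 4" by simp
  have mem: "x \<in> vec.span {y, z}" if "x = \<alpha> *s y + \<beta> *s z" for x y z :: "'f ^ 6" and \<alpha> \<beta>
    using that unfolding span_pair by blast
  \<comment> \<open>The factor \<open>q $ 1\<close> is the right one because every diagonal point
    below is normalised to first coordinate 1.\<close>
  have meet: "vec.span {x, y} \<inter> vec.span {z, z'} = vec.span {p}"
    if "p = \<alpha> *s x + \<beta> *s y" "p = \<gamma> *s z + \<delta> *s z'"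
      "\<And>q \<alpha> \<beta> \<gamma> \<delta>. q = \<alpha> *s x + \<beta> *s y \<Longrightarrow> q = \<gamma> *s z + \<delta> *s z' \<Longrightarrow> q = (q $ 1) *s p"
    for x y z z' p :: "'f ^ 6" and \<alpha> \<beta> \<gamma> \<delta>
  proof (intro equalityI subsetI)
    fix q assume "q \<in> vec.span {x, y} \<inter> vec.span {z, z'}"
    then obtain \<alpha> \<beta> \<gamma> \<delta> where "q = \<alpha> *s x + \<beta> *s y" "q = \<gamma> *s z + \<delta> *s z'"
      unfolding span_pair by blast
    then have "q = (q $ 1) *s p" by (rule that(3))
    then show "q \<in> vec.span {p}" unfolding vec.span_singleton by (rule range_eqI)
  next
    fix q assume "q \<in> vec.span {p}"
    moreover have "vec.span {p} \<subseteq> vec.span {x, y} \<inter> vec.span {z, z'}"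
      using mem[OF that(1)] mem[OF that(2)] by (simp add: span_singleton_subset_iff)
    ultimately show "q \<in> vec.span {x, y} \<inter> vec.span {z, z'}" by blast
  qed
  \<comment> \<open>R1 = A + B = -C - D, R2 = -A - C = B + D and R3 = -A - D = B + C; these are the
    scalars handed to \<open>meet\<close>.\<close>
  let ?R1 = "vector [1, 0, 0, 1, 0, 0] :: 'f ^ 6" and ?R2 = "vector [1, -1, 0, -1, 0, 0] :: 'f ^ 6"
    and ?R3 = "vector [1, 1, 0, -1, 0, 0] :: 'f ^ 6"
  have "vec.span {?A, ?B} \<inter> vec.span {?C, ?D} = vec.span {?R1}"
    by (rule meet[of _ 1 _ 1 _ "-1" _ "-1"])
      (auto simp: vec_eq_iff forall_6 two_eq three_eq)
  moreover have "vec.span {?A, ?C} \<inter> vec.span {?B, ?D} = vec.span {?R2}"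
    by (rule meet[of _ "-1" _ "-1" _ 1 _ 1])
      (auto simp: vec_eq_iff forall_6 two_eq three_eq eq_neg_iff_add_eq_0)
  moreover have "vec.span {?A, ?D} \<inter> vec.span {?B, ?C} = vec.span {?R3}"
    by (rule meet[of _ "-1" _ "-1" _ 1 _ 1])
      (auto simp: vec_eq_iff forall_6 two_eq three_eq eq_neg_iff_add_eq_0)
  moreover have "?R1 \<noteq> 0" "?R2 \<noteq> 0" "?R3 \<noteq> 0" by (auto simp: vec_eq_iff forall_6)
  ultimately have "diagonal_triangle {pt ?A, pt ?B, pt ?C, pt ?D} = {pt ?R1, pt ?R2, pt ?R3}"
    using card unfolding pt_def
    by (intro diagonal_triangle_eq join_lines_linear_image[OF L inj]) simp_all
  then have "witt_points l = pt ` witt_vectors"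
    unfolding witt_points_def affine unfolding image_l witt_vectors_eq image_Un by simp
  then have "witt_points l = (\<lambda>v. vec.span {v}) ` L ` witt_vectors"
    by (simp add: pt_def image_image)
  then show ?thesis using L bij by blast
qed

text \<open>Composition with \<open>L\<close> turns functionals on the image into functionals on the
  coordinate vectors, where the zeros have been counted.\<close>

lemma witt_vectors_image_sections:
  fixes L :: "'f ^ 6 \<Rightarrow> 'f ^ 6"
  assumes L: "Vector_Spaces.linear (*s) (*s) L" "bij L"
  defines "K \<equiv> (\<lambda>v. vec.span {v}) ` L ` witt_vectors"
  shows "K \<subseteq> pg_points" "card K = 12" "sextuple_sections K"
proof -
  have inj: "inj L" using L(2) by (simp add: bij_def)
  have L0: "L 0 = 0" by (rule vec.linear_0[OF L(1)])
  have zero: "0 \<notin> L ` witt_vectors"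
  proof
    assume "0 \<in> L ` witt_vectors"
    then obtain x where "x \<in> witt_vectors" "L x = L 0" unfolding L0 by auto
    then show False using inj by (auto simp: inj_eq witt_vectors_nonzero)
  qed
  have inj_span: "inj_on (\<lambda>v. vec.span {v}) (L ` witt_vectors)"
  proof (rule inj_onI, elim imageE)
    fix p q x y assume eq: "vec.span {p} = vec.span {q}" and p: "p = L x" and q: "q = L y"
      and x: "x \<in> witt_vectors" and y: "y \<in> witt_vectors"
    have "x \<noteq> 0" using x by (auto simp: witt_vectors_nonzero)
    then obtain c where c: "x = c *s y"
      using inj_linear_span_eqD[OF L(1) inj] eq unfolding p q by blast
    have "c = 1"
      using witt_vectors_normalized[OF x] witt_vectors_normalized[OF y] unfolding c by auto
    then show "p = q" using c p q by simp
  qed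
  show "K \<subseteq> pg_points" using zero by (auto simp: K_def)
  have "card K = card (witt_vectors :: ('f ^ 6) set)"
    unfolding K_def by (simp add: card_image[OF inj_span] card_image inj_on_subset[OF inj])
  then show "card K = 12" by (simp add: card_witt_vectors)
  show "sextuple_sections K"
    unfolding K_def sextuple_sections_span_image[OF zero inj_span]
  proof (intro allI impI)
    fix f :: "'f ^ 6 \<Rightarrow> 'f" and z
    assume f: "functional f" "f z \<noteq> 0" and c: "card {v \<in> L ` witt_vectors. f v = 0} > 3"
    have fL: "functional (\<lambda>x. f (L x))"
      using f(1) L(1) by (simp add: Vector_Spaces.linear_iff)
    obtain z' where "z = L z'" using L(2) by (metis bij_pointE)
    then have nz: "f (L z') \<noteq> 0" using f(2) by simp
    have "{v \<in> L ` witt_vectors. f v = 0} = L ` {x \<in> witt_vectors. f (L x) = 0}" by auto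
    then have eq: "card {v \<in> L ` witt_vectors. f v = 0} = card {x \<in> witt_vectors. f (L x) = 0}"
      by (simp add: card_image inj_on_subset[OF inj])
    show "card {v \<in> L ` witt_vectors. f v = 0} = 6"
      using witt_vectors_sections[OF fL nz] c unfolding eq .
  qed
qed

end

subsection \<open>Uniqueness\<close>

text \<open>The induced 5-cycle a, b, c, d, e. Both orders of each pair are listed, so every
  off-diagonal sign of the later matrix can be read off.\<close>

definition pentagon_on :: "('i \<Rightarrow> 'i \<Rightarrow> bool) \<Rightarrow> 'i \<Rightarrow> 'i \<Rightarrow> 'i \<Rightarrow> 'i \<Rightarrow> 'i \<Rightarrow> bool"
  where "pentagon_on s a b c d e \<longleftrightarrow> distinct [a, b, c, d, e] \<and>
    s a b \<and> s b c \<and> s c d \<and> s d e \<and> s e a \<and> s b a \<and> s c b \<and> s d c \<and> s e d \<and> s a e \<and>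
    \<not> s a c \<and> \<not> s b d \<and> \<not> s c e \<and> \<not> s d a \<and> \<not> s e b \<and>
    \<not> s c a \<and> \<not> s d b \<and> \<not> s e c \<and> \<not> s a d \<and> \<not> s b e"

text \<open>Turns the counting conditions into sums of truth values, which case distinction can
  settle.\<close>

lemma card_filter_5:
  assumes "distinct [a, b, c, d, e]"
  shows "card {x \<in> {a, b, c, d, e}. P x} =
    of_bool (P a) + of_bool (P b) + of_bool (P c) + of_bool (P d) + of_bool (P e)"
proof -
  have "card {x \<in> {a, b, c, d, e}. P x} = (\<Sum>x\<in>{a, b, c, d, e}. of_bool (P x))"
    by (simp add: Int_def conj_commute)
  then show ?thesis using assms by simp
qed

lemma remaining_three:
  assumes "card I = 5" "i \<in> I" "j \<in> I" "i \<noteq> j"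
  obtains k l m where "I = {i, j, k, l, m}" "distinct [i, j, k, l, m]"
proof -
  have fin: "finite I" using assms(1) by (metis card.infinite zero_neq_numeral)
  then have "card (I - {i, j}) = 3" using assms by (simp add: card_Diff_subset)
  then obtain k l m where klm: "I - {i, j} = {k, l, m}" "k \<noteq> l" "k \<noteq> m" "l \<noteq> m"
    by (auto simp: card_3_iff)
  then have "k \<in> I - {i, j}" "l \<in> I - {i, j}" "m \<in> I - {i, j}" by simp_all
  moreover have "I = {i, j} \<union> (I - {i, j})" using assms(2,3) by auto
  ultimately show ?thesis using klm assms(4) by (intro that[of k l m]) auto
qed

text \<open>The conditions force \<open>s\<close> to be symmetric off the diagonal, hence a
  2-regular graph on five vertices. A triangle would leave two vertices without enough neighbours,
  so it is a 5-cycle.\<close>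

lemma pentagon_exists:
  assumes card: "card I = 5"
    and two: "\<And>i. i \<in> I \<Longrightarrow> card {j \<in> I. j \<noteq> i \<and> s i j} = 2"
    and one: "\<And>i j. i \<in> I \<Longrightarrow> j \<in> I \<Longrightarrow> i \<noteq> j \<Longrightarrow>
      card {k \<in> I. k \<noteq> i \<and> k \<noteq> j \<and> (s i k \<longleftrightarrow> s j k)} = 1"
  shows "\<exists>a b c d e. I = {a, b, c, d, e} \<and> pentagon_on s a b c d e"
proof -
  \<comment> \<open>Parity: rows \<open>i\<close> and \<open>j\<close> differ in two of the other
    three columns, so their sums over these columns have equal parity; as both row totals are 2,
    \<open>s i j\<close> and \<open>s j i\<close> coincide.\<close>
  have sym: "s i j \<longleftrightarrow> s j i" if ij: "i \<in> I" "j \<in> I" "i \<noteq> j" for i j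
  proof -
    obtain k l m where I: "I = {i, j, k, l, m}" and dist: "distinct [i, j, k, l, m]"
      using remaining_three[OF card ij] .
    have ne: "i \<noteq> j" "j \<noteq> i" "k \<noteq> i" "l \<noteq> i" "m \<noteq> i" "k \<noteq> j" "l \<noteq> j" "m \<noteq> j"
      using dist by auto
    have "of_bool (s i j) + of_bool (s i k) + of_bool (s i l) + of_bool (s i m) = (2::nat)"
      using two[OF ij(1)] unfolding I card_filter_5[OF dist]
      by (simp only: ne simp_thms of_bool_eq add_0 add_0_right)
    moreover have "of_bool (s j i) + of_bool (s j k) + of_bool (s j l) + of_bool (s j m) = (2::nat)"
      using two[OF ij(2)] unfolding I card_filter_5[OF dist]
      by (simp only: ne simp_thms of_bool_eq add_0 add_0_right)
    moreover have "of_bool (s i k \<longleftrightarrow> s j k) + of_bool (s i l \<longleftrightarrow> s j l) +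
        of_bool (s i m \<longleftrightarrow> s j m) = (1::nat)"
      using one[OF ij] unfolding I card_filter_5[OF dist]
      by (simp only: ne simp_thms of_bool_eq add_0 add_0_right)
    ultimately show ?thesis
      by (cases "s i j"; cases "s j i"; cases "s i k"; cases "s i l"; cases "s i m";
          cases "s j k"; cases "s j l"; cases "s j m"; simp)
  qed
  obtain a where a: "a \<in> I" using card by (metis card.empty ex_in_conv zero_neq_numeral)
  from two[OF a] obtain b e where be: "{j \<in> I. j \<noteq> a \<and> s a j} = {b, e}" "b \<noteq> e"
    by (auto simp: card_2_iff)
  from be(1) have b: "b \<in> I" "b \<noteq> a" "s a b" by blast+
  from be(1) have e: "e \<in> I" "e \<noteq> a" "s a e" by blast+
  obtain x y z where xyz: "I = {b, e, x, y, z}" "distinct [b, e, x, y, z]"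
    using remaining_three[OF card b(1) e(1) be(2)] .
  have "\<exists>x y. I = {a, b, e, x, y} \<and> distinct [a, b, e, x, y]"
  proof -
    consider "a = x" | "a = y" | "a = z" using a b(2) e(2) xyz(1) by blast
    then show ?thesis
    proof cases
      case 1
      with xyz show ?thesis by (intro exI[of _ y] exI[of _ z]) auto
    next
      case 2
      with xyz show ?thesis by (intro exI[of _ x] exI[of _ z]) auto
    next
      case 3
      with xyz show ?thesis by (intro exI[of _ x] exI[of _ y]) auto
    qed
  qed
  then obtain x y where I: "I = {a, b, e, x, y}" and dist: "distinct [a, b, e, x, y]" by blast
  have mem: "a \<in> I" "b \<in> I" "e \<in> I" "x \<in> I" "y \<in> I" unfolding I by simp_all
  have "x \<notin> {j \<in> I. j \<noteq> a \<and> s a j}" "y \<notin> {j \<in> I. j \<noteq> a \<and> s a j}"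
    using dist unfolding be(1) by auto
  then have na: "\<not> s a x" "\<not> s a y" using mem dist by auto
  have ne: "b \<noteq> a" "e \<noteq> a" "x \<noteq> a" "y \<noteq> a" "e \<noteq> b" "x \<noteq> b" "y \<noteq> b" "x \<noteq> e" "y \<noteq> e" "y \<noteq> x"
    using dist by auto
  have syms: "s b a = s a b" "s e a = s a e" "s x a = s a x" "s y a = s a y" "s e b = s b e"
    "s x b = s b x" "s y b = s b y" "s x e = s e x" "s y e = s e y" "s y x = s x y"
    by (rule sym; fact)+
  note simps = ne ne[symmetric] syms simp_thms of_bool_eq add_0 add_0_right
  have "of_bool (s b e) + of_bool (s b x) + of_bool (s b y) = (1::nat)"
    using two[OF mem(2)] unfolding I card_filter_5[OF dist] by (simp add: simps b(3))
  moreover have "of_bool (s b e) + of_bool (s e x) + of_bool (s e y) = (1::nat)"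
    using two[OF mem(3)] unfolding I card_filter_5[OF dist] by (simp add: simps e(3))
  moreover have "of_bool (s b x) + of_bool (s e x) + of_bool (s x y) = (2::nat)"
    using two[OF mem(4)] unfolding I card_filter_5[OF dist] by (simp add: simps na)
  moreover have "of_bool (s b y) + of_bool (s e y) + of_bool (s x y) = (2::nat)"
    using two[OF mem(5)] unfolding I card_filter_5[OF dist] by (simp add: simps na)
  \<comment> \<open>The neighbours of \<open>a\<close> are \<open>b\<close> and \<open>e\<close>.
    The degrees leave only the path from \<open>b\<close> to \<open>e\<close> through
    \<open>x\<close> and \<open>y\<close>, in one of two orders.\<close>
  ultimately have "s b x \<and> \<not> s b y \<and> s e y \<and> \<not> s e x \<and> s x y \<and> \<not> s b e \<or>
      s b y \<and> \<not> s b x \<and> s e x \<and> \<not> s e y \<and> s x y \<and> \<not> s b e"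
    by (cases "s b e"; cases "s b x"; cases "s b y"; cases "s e x"; cases "s e y"; cases "s x y";
        simp)
  then show ?thesis
  proof
    assume "s b x \<and> \<not> s b y \<and> s e y \<and> \<not> s e x \<and> s x y \<and> \<not> s b e"
    then have "pentagon_on s a b x y e"
      using b e na dist by (auto simp: pentagon_on_def syms)
    moreover have "I = {a, b, x, y, e}" unfolding I by auto
    ultimately show ?thesis by blast
  next
    assume "s b y \<and> \<not> s b x \<and> s e x \<and> \<not> s e y \<and> s x y \<and> \<not> s b e"
    then have "pentagon_on s a b y x e"
      using b e na dist by (auto simp: pentagon_on_def syms)
    moreover have "I = {a, b, y, x, e}" unfolding I by auto
    ultimately show ?thesis by blast
  qed
qed

text \<open>As columns of a matrix these vectors generate the extended ternary Golay code by its
  rows: unit vectors beside a symmetric matrix with zero diagonal, a border of ones and the signs of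
  a pentagon.\<close>

definition pentagon_vectors :: "('f::field ^ 6) set"
  where "pentagon_vectors = {
    vector [0, 1, 1, 1, 1, 1], vector [1, 0, 1, -1, -1, 1], vector [1, 1, 0, 1, -1, -1],
    vector [1, -1, 1, 0, 1, -1], vector [1, -1, -1, 1, 0, 1], vector [1, 1, -1, -1, 1, 0],
    vector [1, 0, 0, 0, 0, 0], vector [0, 1, 0, 0, 0, 0], vector [0, 0, 1, 0, 0, 0],
    vector [0, 0, 0, 1, 0, 0], vector [0, 0, 0, 0, 1, 0], vector [0, 0, 0, 0, 0, 1]}"

section \<open>The matrix of the other six points over a basis\<close>

locale sextuple_frame = gf3 field_type for field_type :: "'f::field itself" +
  fixes V B :: "('f ^ 6) set"
  assumes card_V: "card V = 12"
    and basis: "B \<subseteq> V" "vec.independent B" "vec.span B = UNIV"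
    and sections: "\<And>f w. functional f \<Longrightarrow> f w \<noteq> 0 \<Longrightarrow> card {v \<in> V. f v = 0} > 3 \<Longrightarrow>
      card {v \<in> V. f v = 0} = 6"
begin

abbreviation W :: "('f ^ 6) set" where "W \<equiv> V - B"

definition coord :: "'f ^ 6 \<Rightarrow> 'f ^ 6 \<Rightarrow> 'f"
  where "coord b v = vec.representation B v b"

lemma finite_V: "finite V"
  using card_V by (metis card.infinite zero_neq_numeral)

lemma finite_B: "finite B"
  using basis(1) finite_V by (rule finite_subset)

lemma card_B: "card B = 6"
proof -
  have "vec.dim (vec.span B) = card B" by (rule vec.dim_span_eq_card_independent[OF basis(2)])
  then show ?thesis unfolding basis(3) vec_dim_card by simp
qed

lemma card_W: "card W = 6"
  using card_Diff_subset[OF finite_B basis(1)] by (simp add: card_V card_B)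

lemma functional_coord: "functional (coord b)"
  unfolding coord_def[abs_def] by (rule vec.linear_representation[OF basis(2,3)])

lemma coord_basis: "c \<in> B \<Longrightarrow> coord b c = (if b = c then 1 else 0)"
  by (simp add: coord_def vec.representation_basis[OF basis(2)])

lemma expansion: "v = (\<Sum>b\<in>B. coord b v *s b)"
  unfolding coord_def
  by (rule vec.sum_representation_eq[symmetric]) (use basis finite_B in auto)

lemma card_zeros_split:
  assumes "functional f"
  shows "card {v \<in> V. f v = 0} = card {b \<in> B. f b = 0} + card {w \<in> W. f w = 0}"
proof -
  have "{v \<in> V. f v = 0} = {b \<in> B. f b = 0} \<union> {w \<in> W. f w = 0}" using basis(1) by blast
  moreover have "{b \<in> B. f b = 0} \<inter> {w \<in> W. f w = 0} = {}" by blast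
  ultimately show ?thesis using finite_B finite_V by (simp add: card_Un_disjoint)
qed

text \<open>The functional \<open>coord b\<close> vanishes at five basis vectors, so its section has
  exactly six points and one is left for \<open>W\<close>.\<close>

lemma card_coord_zeros:
  assumes "b \<in> B"
  shows "card {w \<in> W. coord b w = 0} = 1"
proof -
  have "{c \<in> B. coord b c = 0} = B - {b}" using assms by (auto simp: coord_basis)
  then have five: "card {c \<in> B. coord b c = 0} = 5" using assms finite_B by (simp add: card_B)
  have "coord b b \<noteq> 0" using assms by (simp add: coord_basis)
  from sections[OF functional_coord this] show ?thesis
    unfolding card_zeros_split[OF functional_coord] five by simp
qed

text \<open>The difference functional vanishes at the four basis vectors other than \<open>b\<close>
  and \<open>c\<close>, which leaves two of the six points for \<open>W\<close>.\<close>

lemma card_coord_proportional: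
  assumes bc: "b \<in> B" "c \<in> B" "b \<noteq> c" and k: "k \<noteq> 0"
  shows "card {w \<in> W. coord b w = k * coord c w} = 2"
proof -
  let ?f = "\<lambda>v. coord b v - k * coord c v"
  have f: "functional ?f"
    using functional_coord[of b] functional_coord[of c]
    by (simp add: Vector_Spaces.linear_iff algebra_simps vec.vector_space_axioms)
  have "{x \<in> B. ?f x = 0} = B - {b, c}" using bc k by (auto simp: coord_basis split: if_splits)
  then have four: "card {x \<in> B. ?f x = 0} = 4"
    using bc finite_B by (simp add: card_B card_Diff_subset)
  have "?f b \<noteq> 0" using bc by (simp add: coord_basis)
  from sections[OF f this] have "card {w \<in> W. ?f w = 0} = 2"
    unfolding card_zeros_split[OF f] four by simp
  then show ?thesis by simp
qed

text \<open>Pairs each basis vector with the further point in the hyperplane of the other five, so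
  that the zeros of the matrix lie on its diagonal.\<close>

definition opposite :: "'f ^ 6 \<Rightarrow> 'f ^ 6"
  where "opposite b = (THE w. w \<in> W \<and> coord b w = 0)"

lemma opposite_unique:
  assumes "b \<in> B"
  shows "\<exists>!w. w \<in> W \<and> coord b w = 0"
proof -
  obtain w where "{w \<in> W. coord b w = 0} = {w}"
    using card_coord_zeros[OF assms] by (auto simp: card_1_singleton_iff)
  then show ?thesis by (intro ex1I[of _ w]) blast+
qed

lemma opposite_in: "b \<in> B \<Longrightarrow> opposite b \<in> W"
  using theI'[OF opposite_unique] by (simp add: opposite_def)

lemma coord_opposite: "b \<in> B \<Longrightarrow> coord b (opposite b) = 0"
  using theI'[OF opposite_unique] by (simp add: opposite_def)

lemma opposite_eqI: "b \<in> B \<Longrightarrow> w \<in> W \<Longrightarrow> coord b w = 0 \<Longrightarrow> w = opposite b"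
  using opposite_unique opposite_in coord_opposite by blast

text \<open>If \<open>b\<close> and \<open>c\<close> shared their opposite, their coordinates would
  be equal or opposite at every point of \<open>W\<close>; but each sign accounts for only two of
  the six points.\<close>

lemma inj_opposite: "inj_on opposite B"
proof (rule inj_onI, rule ccontr)
  fix b c assume bc: "b \<in> B" "c \<in> B" "opposite b = opposite c" "b \<noteq> c"
  let ?P = "{w \<in> W. coord b w = 1 * coord c w}" and ?N = "{w \<in> W. coord b w = - 1 * coord c w}"
  have "W \<subseteq> ?P \<union> ?N"
  proof
    fix w assume w: "w \<in> W"
    show "w \<in> ?P \<union> ?N"
    proof (cases "coord b w = 0 \<or> coord c w = 0")
      case True
      then have "w = opposite b" using opposite_eqI bc w by metis
      then have "coord b w = 0" "coord c w = 0"
        using coord_opposite[OF bc(1)] coord_opposite[OF bc(2)] bc(3) by simp_all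
      then show ?thesis using w by simp
    next
      case False
      then show ?thesis using eq_or_eq_minus[of "coord b w" "coord c w"] w by auto
    qed
  qed
  then have "card W \<le> card (?P \<union> ?N)" using finite_V by (intro card_mono) auto
  also have "\<dots> \<le> card ?P + card ?N" by (rule card_Un_le)
  also have "\<dots> = 4"
    using card_coord_proportional[OF bc(1,2,4), of 1] card_coord_proportional[OF bc(1,2,4), of "-1"]
    by simp
  finally show False by (simp add: card_W)
qed

lemma opposite_image: "opposite ` B = W"
  by (rule card_subset_eq)
    (use finite_V opposite_in in \<open>auto simp: card_image[OF inj_opposite] card_B card_W\<close>)

lemma coord_opposite_nonzero:
  assumes "b \<in> B" "c \<in> B" "b \<noteq> c"
  shows "coord b (opposite c) \<noteq> 0"
  using assms opposite_eqI[OF assms(1) opposite_in[OF assms(2)]] inj_opposite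
  by (metis inj_onD)

text \<open>For distinct \<open>b\<close> and \<open>c\<close> other than \<open>p\<close>: the
  entry is 1 rather than -1 once row and column of \<open>p\<close> are scaled to ones. This is the
  adjacency of the pentagon.\<close>

definition agrees :: "'f ^ 6 \<Rightarrow> 'f ^ 6 \<Rightarrow> 'f ^ 6 \<Rightarrow> bool"
  where "agrees p b c \<longleftrightarrow> coord b (opposite c) = coord p (opposite c) * coord b (opposite p)"

lemma coord_opposite_sign:
  assumes "p \<in> B" "b \<in> B" "c \<in> B" "b \<noteq> p" "c \<noteq> p" "b \<noteq> c"
  shows "coord b (opposite c) =
    (if agrees p b c then 1 else -1) * (coord p (opposite c) * coord b (opposite p))"
proof -
  have "coord b (opposite c) \<noteq> 0" "coord p (opposite c) * coord b (opposite p) \<noteq> 0"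
    using assms coord_opposite_nonzero by auto
  from eq_or_eq_minus[OF this] show ?thesis by (auto simp: agrees_def)
qed

text \<open>The two points of \<open>W\<close> with \<open>coord b\<close> equal to
  \<open>?k\<close> times \<open>coord p\<close> are the opposites of the \<open>c\<close> sought;
  for \<open>c = p\<close> and \<open>c = b\<close> exactly one side vanishes.\<close>

lemma card_agrees:
  assumes p: "p \<in> B" and b: "b \<in> B - {p}"
  shows "card {c \<in> B - {p}. c \<noteq> b \<and> agrees p b c} = 2"
proof -
  let ?k = "coord b (opposite p)"
  have k: "?k \<noteq> 0" using p b coord_opposite_nonzero by auto
  have iff: "coord b (opposite c) = ?k * coord p (opposite c) \<longleftrightarrow> c \<noteq> p \<and> c \<noteq> b \<and> agrees p b c"
    if "c \<in> B" for c
  proof -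
    consider "c = p" | "c = b" | "c \<noteq> p" "c \<noteq> b" by blast
    then show ?thesis
    proof cases
      case 1
      then show ?thesis using k coord_opposite[OF p] by simp
    next
      case 2
      then show ?thesis using k p b coord_opposite[of b] coord_opposite_nonzero[of p b] by auto
    next
      case 3
      then show ?thesis by (simp add: agrees_def mult.commute)
    qed
  qed
  have "{w \<in> W. coord b w = ?k * coord p w} = opposite ` {c \<in> B - {p}. c \<noteq> b \<and> agrees p b c}"
    unfolding opposite_image[symmetric] using iff by auto
  moreover have "inj_on opposite {c \<in> B - {p}. c \<noteq> b \<and> agrees p b c}"
    by (rule inj_on_subset[OF inj_opposite]) auto
  ultimately show ?thesis
    using card_coord_proportional[of b p ?k] b p k by (simp add: card_image)
qed

text \<open>Rows \<open>i\<close> and \<open>j\<close> are proportional with factor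
  \<open>?k\<close> at two points of \<open>W\<close>. One of them is \<open>opposite p\<close>, so
  exactly one column of agreement remains.\<close>

lemma card_agrees_pair:
  assumes p: "p \<in> B" and i: "i \<in> B - {p}" and j: "j \<in> B - {p}" and ij: "i \<noteq> j"
  shows "card {k \<in> B - {p}. k \<noteq> i \<and> k \<noteq> j \<and> (agrees p i k \<longleftrightarrow> agrees p j k)} = 1"
    (is "card ?S = 1")
proof -
  \<comment> \<open>The quotient of the two entries in column \<open>p\<close>, since nonzero
    elements are their own inverses.\<close>
  let ?k = "coord i (opposite p) * coord j (opposite p)"
  have nz: "coord i (opposite p) \<noteq> 0" "coord j (opposite p) \<noteq> 0"
    using p i j coord_opposite_nonzero by auto
  have iff: "coord i (opposite k) = ?k * coord j (opposite k) \<longleftrightarrow>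
      k = p \<or> k \<noteq> i \<and> k \<noteq> j \<and> (agrees p i k \<longleftrightarrow> agrees p j k)" if k: "k \<in> B" for k
  proof -
    consider "k = p" | "k = i" | "k = j" | "k \<noteq> p" "k \<noteq> i" "k \<noteq> j" by blast
    then show ?thesis
    proof cases
      case 1
      then show ?thesis using square_eq_one[OF nz(2)] by (simp add: mult.assoc)
    next
      case 2
      then show ?thesis
        using nz i j ij p coord_opposite[of i] coord_opposite_nonzero[of j i] by auto
    next
      case 3
      then show ?thesis
        using nz i j ij p coord_opposite[of j] coord_opposite_nonzero[of i j] by auto
    next
      case 4
      define t where "t = coord p (opposite k)"
      have t: "t \<noteq> 0" unfolding t_def using 4 p k coord_opposite_nonzero by auto
      have ci: "coord i (opposite k) = (if agrees p i k then 1 else -1) * (t * coord i (opposite p))"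
        unfolding t_def using 4 p k i by (intro coord_opposite_sign) auto
      have cj: "coord j (opposite k) = (if agrees p j k then 1 else -1) * (t * coord j (opposite p))"
        unfolding t_def using 4 p k j by (intro coord_opposite_sign) auto
      have "?k * coord j (opposite k) = (if agrees p j k then 1 else -1) *
          (t * coord i (opposite p)) * (coord j (opposite p) * coord j (opposite p))"
        unfolding cj by (simp add: ac_simps)
      then have "?k * coord j (opposite k) =
          (if agrees p j k then 1 else -1) * (t * coord i (opposite p))"
        unfolding square_eq_one[OF nz(2)] by simp
      moreover have "t * coord i (opposite p) \<noteq> 0" using t nz by simp
      ultimately show ?thesis
        unfolding ci using 4 neq_minus_self[of "t * coord i (opposite p)"]
          neq_minus_self[of "t * coord i (opposite p)", symmetric] by simp
    qed
  qed
  have image: "{w \<in> W. coord i w = ?k * coord j w} = opposite ` insert p ?S"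
    unfolding opposite_image[symmetric] using iff p by auto
  have inj: "inj_on opposite (insert p ?S)"
    by (rule inj_on_subset[OF inj_opposite]) (use p in auto)
  have Suc: "card (insert p ?S) = Suc (card ?S)"
    using finite_B by (intro card_insert_disjoint) auto
  have "card {w \<in> W. coord i w = ?k * coord j w} = 2"
    using i j ij nz by (intro card_coord_proportional) auto
  then show ?thesis unfolding image card_image[OF inj] Suc by linarith
qed

text \<open>
  Rescaling the basis vectors other than \<open>p\<close> by \<^term>\<open>coord b (opposite p)\<close> turns
  \<^term>\<open>opposite p\<close> into the sum of these vectors; then the points are those of
  \<^const>\<open>pentagon_vectors\<close>.
\<close>

lemma pentagon_coordinates:
  "\<exists>L. Vector_Spaces.linear (*s) (*s) L \<and> bij L \<and>
    (\<lambda>v. vec.span {v}) ` V = (\<lambda>v. vec.span {v}) ` L ` pentagon_vectors"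
proof -
  obtain p where p: "p \<in> B" using card_B by (metis card.empty ex_in_conv zero_neq_numeral)
  have "card (B - {p}) = 5" using p finite_B by (simp add: card_B)
  then obtain a b c d e where abcde: "B - {p} = {a, b, c, d, e}"
    and pent: "pentagon_on (agrees p) a b c d e"
    using pentagon_exists[of "B - {p}" "agrees p"] card_agrees[OF p] card_agrees_pair[OF p] by blast
  have dist: "distinct [p, a, b, c, d, e]"
    using pent abcde by (auto simp: pentagon_on_def)
  have B: "B = {p, a, b, c, d, e}" using p abcde by auto
  then have mem: "a \<in> B" "b \<in> B" "c \<in> B" "d \<in> B" "e \<in> B" by simp_all
  have ne: "a \<noteq> p" "b \<noteq> p" "c \<noteq> p" "d \<noteq> p" "e \<noteq> p" using dist by auto
  define \<beta> where "\<beta> x = coord x (opposite p) *s x" for x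
  have scale: "coord x (opposite p) \<noteq> 0" if "x \<in> B" "x \<noteq> p" for x
    using that p coord_opposite_nonzero by auto
  let ?b = "($) (vector [p, \<beta> a, \<beta> b, \<beta> c, \<beta> d, \<beta> e] :: 'f ^ 6 ^ 6)"
  define L where "L = lin_comb ?b"
  have L_vector: "L (vector [x1, x2, x3, x4, x5, x6]) =
      x1 *s p + x2 *s \<beta> a + x3 *s \<beta> b + x4 *s \<beta> c + x5 *s \<beta> d + x6 *s \<beta> e" for x1 x2 x3 x4 x5 x6
    by (simp add: L_def lin_comb_def sum_6)
  have span_\<beta>: "vec.span {\<beta> x} = vec.span {x}" if "x \<in> B" "x \<noteq> p" for x
    unfolding \<beta>_def using scale[OF that] by (rule span_scaled)
  have "bij L"
    unfolding L_def
  proof (rule bij_lin_comb)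
    have gen: "?b i \<in> vec.span (range ?b)" for i by (rule vec.span_base) simp
    have base: "x \<in> vec.span (range ?b)" if "x \<in> B" "x \<noteq> p" "\<beta> x = ?b i" for x i
    proof -
      have "x \<in> vec.span {\<beta> x}" unfolding span_\<beta>[OF that(1,2)] by (simp add: vec.span_base)
      moreover have "vec.span {\<beta> x} \<subseteq> vec.span (range ?b)"
        unfolding that(3) using gen[of i] by (simp add: span_singleton_subset_iff)
      ultimately show ?thesis by blast
    qed
    have "p \<in> vec.span (range ?b)" using gen[of 1] by simp
    moreover have "a \<in> vec.span (range ?b)" by (rule base[of _ 2]) (use mem dist in auto)
    moreover have "b \<in> vec.span (range ?b)" by (rule base[of _ 3]) (use mem dist in auto)
    moreover have "c \<in> vec.span (range ?b)" by (rule base[of _ 4]) (use mem dist in auto)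
    moreover have "d \<in> vec.span (range ?b)" by (rule base[of _ 5]) (use mem dist in auto)
    moreover have "e \<in> vec.span (range ?b)" by (rule base[of _ 6]) (use mem dist in auto)
    ultimately have "B \<subseteq> vec.span (range ?b)" unfolding B by simp
    then have "vec.span B \<subseteq> vec.span (range ?b)" by (rule vec.span_minimal) simp
    then show "vec.span (range ?b) = UNIV" unfolding basis(3) by blast
  qed
  moreover have "Vector_Spaces.linear (*s) (*s) L" unfolding L_def by (rule linear_lin_comb)
  moreover have "(\<lambda>v. vec.span {v}) ` V = (\<lambda>v. vec.span {v}) ` L ` pentagon_vectors"
  proof -
    have sum_B: "v = coord p v *s p + coord a v *s a + coord b v *s b + coord c v *s c
        + coord d v *s d + coord e v *s e" for v
    proof -
      have "v = (\<Sum>b\<in>{p, a, b, c, d, e}. coord b v *s b)" using expansion[of v] unfolding B .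
      then show ?thesis using dist by (simp add: ac_simps)
    qed
    \<comment> \<open>The normalised sign matrix, row \<open>y\<close> and column \<open>x\<close>
      in \<open>\<epsilon> y x\<close>.\<close>
    define \<epsilon> where "\<epsilon> x y = (if x = y then 0 else if agrees p x y then 1 else -1 :: 'f)" for x y
    have opp_p: "opposite p = L (vector [0, 1, 1, 1, 1, 1])"
      using sum_B[of "opposite p"] coord_opposite[OF p] by (simp add: L_vector \<beta>_def)
    have opp: "vec.span {opposite x} =
        vec.span {L (vector [1, \<epsilon> a x, \<epsilon> b x, \<epsilon> c x, \<epsilon> d x, \<epsilon> e x])}"
      if x: "x \<in> B" "x \<noteq> p" for x
    proof -
      \<comment> \<open>Being its own inverse, \<open>t\<close> scales the
        \<open>p\<close>-coordinate of \<open>opposite x\<close> to 1.\<close>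
      define t where "t = coord p (opposite x)"
      have t: "t \<noteq> 0" unfolding t_def using coord_opposite_nonzero p x by auto
      have entry: "(t * coord y (opposite x)) *s y = \<epsilon> y x *s \<beta> y" if y: "y \<in> B" "y \<noteq> p" for y
      proof (cases "y = x")
        case True
        then show ?thesis using coord_opposite[OF x(1)] by (simp add: \<epsilon>_def)
      next
        case False
        have "coord y (opposite x) = \<epsilon> y x * (t * coord y (opposite p))"
          using coord_opposite_sign[OF p y(1) x(1) y(2) x(2) False] False by (simp add: t_def \<epsilon>_def)
        then have "t * coord y (opposite x) = (t * t) * (\<epsilon> y x * coord y (opposite p))"
          by (simp add: ac_simps)
        then have "t * coord y (opposite x) = \<epsilon> y x * coord y (opposite p)"
          unfolding square_eq_one[OF t] by simp
        then show ?thesis by (simp add: \<beta>_def)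
      qed
      have "t *s opposite x = (t * coord p (opposite x)) *s p + (t * coord a (opposite x)) *s a
          + (t * coord b (opposite x)) *s b + (t * coord c (opposite x)) *s c
          + (t * coord d (opposite x)) *s d + (t * coord e (opposite x)) *s e"
        using arg_cong[OF sum_B[of "opposite x"], of "(*s) t"] by (simp add: vec.scale_right_distrib)
      also have "t * coord p (opposite x) = 1" using square_eq_one[OF t] by (simp add: t_def)
      finally have "t *s opposite x = L (vector [1, \<epsilon> a x, \<epsilon> b x, \<epsilon> c x, \<epsilon> d x, \<epsilon> e x])"
        unfolding L_vector entry[OF mem(1) ne(1)] entry[OF mem(2) ne(2)] entry[OF mem(3) ne(3)]
          entry[OF mem(4) ne(4)] entry[OF mem(5) ne(5)] .
      then show ?thesis using span_scaled[OF t, of "opposite x"] by simp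
    qed
    have signs:
      "\<epsilon> a a = 0" "\<epsilon> b a = 1" "\<epsilon> c a = -1" "\<epsilon> d a = -1" "\<epsilon> e a = 1"
      "\<epsilon> a b = 1" "\<epsilon> b b = 0" "\<epsilon> c b = 1" "\<epsilon> d b = -1" "\<epsilon> e b = -1"
      "\<epsilon> a c = -1" "\<epsilon> b c = 1" "\<epsilon> c c = 0" "\<epsilon> d c = 1" "\<epsilon> e c = -1"
      "\<epsilon> a d = -1" "\<epsilon> b d = -1" "\<epsilon> c d = 1" "\<epsilon> d d = 0" "\<epsilon> e d = 1"
      "\<epsilon> a e = 1" "\<epsilon> b e = -1" "\<epsilon> c e = -1" "\<epsilon> d e = 1" "\<epsilon> e e = 0"
      using pent by (auto simp: \<epsilon>_def pentagon_on_def)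
    have image_B: "g ` B = {g p, g a, g b, g c, g d, g e}" for g :: "'f ^ 6 \<Rightarrow> ('f ^ 6) set"
      by (subst B) simp
    have "B \<union> W = V" using basis(1) by blast
    then have "(\<lambda>v. vec.span {v}) ` V = (\<lambda>v. vec.span {v}) ` B \<union> (\<lambda>v. vec.span {v}) ` W"
      by (simp only: image_Un[symmetric])
    also have "(\<lambda>v. vec.span {v}) ` W = (\<lambda>v. vec.span {opposite v}) ` B"
      unfolding opposite_image[symmetric] by (simp only: image_image)
    also have "(\<lambda>v. vec.span {v}) ` B \<union> (\<lambda>v. vec.span {opposite v}) ` B =
        {vec.span {p}, vec.span {a}, vec.span {b}, vec.span {c}, vec.span {d}, vec.span {e}} \<union>
        {vec.span {opposite p}, vec.span {opposite a}, vec.span {opposite b},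
        vec.span {opposite c}, vec.span {opposite d}, vec.span {opposite e}}"
      unfolding image_B ..
    \<comment> \<open>Rescaling does not change the points; now they are images of unit vectors
      under \<open>L\<close>.\<close>
    also have "\<dots> = {vec.span {p}, vec.span {\<beta> a}, vec.span {\<beta> b}, vec.span {\<beta> c},
        vec.span {\<beta> d}, vec.span {\<beta> e}} \<union> {vec.span {opposite p}, vec.span {opposite a},
        vec.span {opposite b}, vec.span {opposite c}, vec.span {opposite d}, vec.span {opposite e}}"
      unfolding span_\<beta>[OF mem(1) ne(1)] span_\<beta>[OF mem(2) ne(2)] span_\<beta>[OF mem(3) ne(3)]
        span_\<beta>[OF mem(4) ne(4)] span_\<beta>[OF mem(5) ne(5)] ..
    also have "\<dots> = (\<lambda>v. vec.span {v}) ` L ` pentagon_vectors"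
      unfolding opp[OF mem(1) ne(1)] opp[OF mem(2) ne(2)] opp[OF mem(3) ne(3)]
        opp[OF mem(4) ne(4)] opp[OF mem(5) ne(5)] opp_p signs
      by (simp add: pentagon_vectors_def L_vector)
    finally show ?thesis .
  qed
  ultimately show ?thesis by blast
qed

end

text \<open>The representatives span the space, since otherwise some hyperplane would contain all
  twelve points instead of six; hence a basis can be chosen among them.\<close>

theorem (in gf3) sextuple_sections_pentagon_coordinates:
  fixes K :: "('f ^ 6) set set"
  assumes K: "K \<subseteq> pg_points" "card K = 12" "sextuple_sections K"
  shows "\<exists>L. Vector_Spaces.linear (*s) (*s) L \<and> bij L \<and>
    K = (\<lambda>v. vec.span {v}) ` L ` pentagon_vectors"
proof -
  obtain V where V: "0 \<notin> V" "inj_on (\<lambda>v. vec.span {v}) V" "K = (\<lambda>v. vec.span {v}) ` V"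
    using K(1) by (rule points_representatives)
  have card: "card V = 12" using K(2) unfolding V(3) card_image[OF V(2)] .
  have sec: "card {v \<in> V. f v = 0} = 6"
    if "functional f" "f w \<noteq> 0" "card {v \<in> V. f v = 0} > 3" for f w
    using K(3) that unfolding V(3) sextuple_sections_span_image[OF V(1,2)] by blast
  obtain B where B: "B \<subseteq> V" "vec.independent B" "V \<subseteq> vec.span B"
    by (rule vec.maximal_independent_subset)
  have "vec.span B = UNIV"
  proof (rule ccontr)
    assume "vec.span B \<noteq> UNIV"
    then obtain f w where f: "functional f" "f w \<noteq> 0" "\<forall>x\<in>B. f x = 0"
      using functional_vanishing_on by blast
    have "vec.span B \<subseteq> {x. f x = 0}"
      using f(3) by (intro vec.span_minimal subspace_kernel[OF f(1)]) blast
    then have "{v \<in> V. f v = 0} = V" using B(3) by blast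
    then show False using sec[OF f(1,2)] card by simp
  qed
  then interpret sextuple_frame field_type V B
    using card B sec by unfold_locales
  show ?thesis using pentagon_coordinates unfolding V(3) .
qed

section \<open>The design and its projective uniqueness\<close>

theorem mainTheorem3:
  fixes l_inf :: "(('f::field ^ 3) set) set"
  assumes "CARD('f) = 3"
    and "pg_line l_inf"
  shows "is_design 5 12 6 1 (witt_points l_inf) (hyperplane_blocks (witt_points l_inf)) \<and>
    (\<forall>K'. K' \<subseteq> pg_points \<and> is_design 5 12 6 1 K' (hyperplane_blocks K') \<longrightarrow>
      (\<exists>\<kappa>. pg_collineation \<kappa> \<and> \<kappa> ` witt_points l_inf = K'))"
proof -
  interpret gf3 "TYPE('f)" using assms(1) by unfold_locales
  let ?K = "witt_points l_inf"
  from witt_points_coordinates[OF assms(2)] obtain M :: "'f ^ 6 \<Rightarrow> 'f ^ 6"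
    where M: "Vector_Spaces.linear (*s) (*s) M" "bij M"
      "?K = (\<lambda>v. vec.span {v}) ` M ` witt_vectors"
    by (elim exE conjE)
  have K: "?K \<subseteq> pg_points" "card ?K = 12" "sextuple_sections ?K"
    unfolding M(3) using witt_vectors_image_sections[OF M(1,2)] by simp_all
  have "is_design 5 12 6 1 ?K (hyperplane_blocks ?K)"
    using design_iff_sextuple_sections[OF K(1)] K(2,3) by simp
  moreover have "\<exists>\<kappa>. pg_collineation \<kappa> \<and> \<kappa> ` ?K = K'"
    if K': "K' \<subseteq> pg_points" "is_design 5 12 6 1 K' (hyperplane_blocks K')" for K'
  proof -
    \<comment> \<open>The normal form is applied to both sets, which become linear images of the
      same twelve vectors.\<close>
    from sextuple_sections_pentagon_coordinates[OF K] obtain L :: "'f ^ 6 \<Rightarrow> 'f ^ 6"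
      where L: "Vector_Spaces.linear (*s) (*s) L" "bij L"
        "?K = (\<lambda>v. vec.span {v}) ` L ` pentagon_vectors"
      by (elim exE conjE)
    from sextuple_sections_pentagon_coordinates[OF K'(1) design_sextuple_sections[OF K'(2)]]
    obtain L' :: "'f ^ 6 \<Rightarrow> 'f ^ 6"
      where L': "Vector_Spaces.linear (*s) (*s) L'" "bij L'"
        "K' = (\<lambda>v. vec.span {v}) ` L' ` pentagon_vectors"
      by (elim exE conjE)
    define g where "g = L' \<circ> inv L"
    have inj: "inj L" and surj: "surj L" using L(2) by (simp_all add: bij_def)
    have inv: "Vector_Spaces.linear (*s) (*s) (inv L)"
      unfolding Vector_Spaces.linear_iff
    proof (intro conjI allI vec.vector_space_axioms)
      note add = vec.linear_add[OF L(1)] and scale = vec.linear_scale[OF L(1)]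
      show "inv L (x + y) = inv L x + inv L y" for x y
        by (rule inv_f_eq[OF inj]) (simp add: add surj_f_inv_f[OF surj])
      show "inv L (c *s x) = c *s inv L x" for c x
        by (rule inv_f_eq[OF inj]) (simp add: scale surj_f_inv_f[OF surj])
    qed
    have g: "Vector_Spaces.linear (*s) (*s) g"
      unfolding g_def using inv L'(1) by (rule Vector_Spaces.linear_compose)
    have "bij g" unfolding g_def using L(2) L'(2) by (simp add: bij_comp bij_imp_bij_inv)
    then have "pg_collineation ((`) g)" by (rule pg_collineation_linear[OF g])
    moreover have "(`) g ` ?K = K'"
      unfolding L(3) L'(3) image_image linear_image_span_singleton[OF g]
      by (simp add: g_def inj)
    ultimately show ?thesis by blast
  qed
  ultimately show ?thesis by blast
qed

end
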